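(* Let $G$ be a finite group, and consider the lattice topological field theory associated with the group algebra $R=\mathbb{C}[G]=\bigoplus_{x\in G}\mathbb{C}\phi_x$, $\phi_x\phi_y=\phi_{xy}$. For each conjugacy class $\alpha$ of $G$, with $h_\alpha$ elements, put $C_\alpha=\frac{1}{\sqrt{h_\alpha}}\sum_{x\in\alpha}\phi_x\in Z(R)$ and let $\mathcal{O}_\alpha=\frac{1}{\sqrt{h_\alpha}}\sum_{x\in\alpha}\mathcal{O}_x$ be the corresponding operator. Then for every genus $g\ge0$ and all conjugacy classes $\alpha_1,\dots,\alpha_n$ of $G$, $$\langle\mathcal{O}_{\alpha_1}\cdots\mathcal{O}_{\alpha_n}\rangle_g=\sum_j\frac{\chi_j(C_{\alpha_1})\cdots\chi_j(C_{\alpha_n})}{d_j^{\,2g-2+n}},$$ where $j$ runs over the isomorphism classes of irreducible complex representations of $G$, $\chi_j$ is the character of $j$ extended linearly to $\mathbb{C}[G]$, and $d_j=\chi_j(1)$ is its dimension.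
   Context: The lattice topological field theory associated with $\mathbb{C}[G]$ has color set $G$ and is given by $g_{xy}=|G|\,\delta(xy,1)$, with inverse matrix $g^{xy}=|G|^{-1}\delta(xy,1)$, and $C_{xyz}=|G|\,\delta(xyz,1)$, where $\delta(a,b)=1$ if $a=b$ and $0$ otherwise. Correlation functions: for $g,n\ge 0$ let $\Sigma$ be a compact connected oriented surface of genus $g$ with $n$ boundary circles. Take any way of obtaining $\Sigma$ from finitely many oriented triangles by identifying pairs of edges compatibly with orientation (edges of the same triangle may be identified with each other), such that each boundary circle consists of exactly one unpaired edge. The correlation function $\langle \mathcal{O}_{x_1}\cdots\mathcal{O}_{x_n}\rangle_g$ is defined by giving the $n$ boundary edges the colors $x_1,\dots,x_n\in G$, assigning to each triangle the weight $C_{xyz}$, where $x,y,z$ are the colors of its three sides in the cyclic order given by the orientation, assigning to each pair of identified sides with colors $x,y$ the factor $g^{xy}$, and summing the product of all factors over all colors of the non-boundary sides. The value does not depend on the chosen triangulation. Correlation functions are extended multilinearly to linear combinations of the symbols $\mathcal{O}_x$. *)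

theory Defs
  imports
    "HOL-Algebra.Group_Action"
    "Jordan_Normal_Form.VS_Connect"
begin

text \<open>
  Gluings of oriented triangles. A triangle has sides 0, 1, 2 in the cyclic order given by its
  orientation and corners 0, 1, 2, where side i runs from corner i to corner i + 1 (mod 3). So a
  pair \<open>(t, i)\<close> stands for a side, and also for the corner at which that side starts.

  \<open>gl_pairs\<close> lists the identified pairs of sides, each of them once and in an arbitrary order;
  \<open>gl_bdry\<close> enumerates the unpaired sides (so it fixes which boundary circle carries which
  operator). Two identified sides are glued with opposite directions, as compatibility with the
  orientations demands. The quotient is then automatically a compact oriented surface with boundary.
\<close>

type_synonym side = "nat \<times> nat"

record gluing =
  gl_tris :: "nat set"
  gl_pairs :: "(side \<times> side) set"
  gl_bdry :: "side list"

definition gl_sides :: "gluing \<Rightarrow> side set" where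
  "gl_sides K = gl_tris K \<times> {0, 1, 2}"

definition next_side :: "side \<Rightarrow> side" where
  "next_side s = (fst s, (snd s + 1) mod 3)"

definition gluing :: "gluing \<Rightarrow> bool" where
  "gluing K \<longleftrightarrow>
     finite (gl_tris K) \<and> gl_pairs K \<subseteq> gl_sides K \<times> gl_sides K \<and>
     (\<forall>(a, b) \<in> gl_pairs K. a \<noteq> b) \<and>
     (\<forall>(a, b) \<in> gl_pairs K. \<forall>(a', b') \<in> gl_pairs K.
        {a, b} \<inter> {a', b'} \<noteq> {} \<longrightarrow> (a, b) = (a', b')) \<and>
     distinct (gl_bdry K) \<and>
     set (gl_bdry K) = gl_sides K - (Domain (gl_pairs K) \<union> Range (gl_pairs K))"

text \<open>Gluing a to b identifies the start of a with the end of b, and the end of a with the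
  start of b. Vertices are the classes of corners under the equivalence generated by this.\<close>

definition gl_corner_rel :: "gluing \<Rightarrow> side rel" where
  "gl_corner_rel K =
     (let R = (\<Union>(a, b) \<in> gl_pairs K. {(a, next_side b), (next_side a, b)}) in (R \<union> R\<inverse>)\<^sup>*)"

definition gl_vertices :: "gluing \<Rightarrow> side set set" where
  "gl_vertices K = gl_sides K // gl_corner_rel K"

definition gl_euler_char :: "gluing \<Rightarrow> int" where
  "gl_euler_char K =
     int (card (gl_vertices K)) - int (card (gl_pairs K) + length (gl_bdry K))
       + int (card (gl_tris K))"

definition gl_connected :: "gluing \<Rightarrow> bool" where
  "gl_connected K \<longleftrightarrow> gl_tris K \<noteq> {} \<and>
     (let R = (\<lambda>(a, b). (fst a, fst b)) ` gl_pairs K in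
        \<forall>s \<in> gl_tris K. \<forall>t \<in> gl_tris K. (s, t) \<in> (R \<union> R\<inverse>)\<^sup>*)"

text \<open>A boundary circle consists of a single unpaired side iff the two ends of that side are the
  same vertex; then the number of boundary circles is the number n of unpaired sides, and the genus
  g of the connected surface is determined by its Euler characteristic 2 - 2 g - n.\<close>

definition triangulates :: "gluing \<Rightarrow> nat \<Rightarrow> nat \<Rightarrow> bool" where
  "triangulates K g n \<longleftrightarrow>
     gluing K \<and> gl_connected K \<and>
     (\<forall>s \<in> set (gl_bdry K). (s, next_side s) \<in> gl_corner_rel K) \<and>
     length (gl_bdry K) = n \<and>
     gl_euler_char K = 2 - 2 * int g - int n"

text \<open>Lattice topological field theory with color set X, triangle weights \<open>C x y z\<close> and inverse
  metric \<open>h x y\<close>.\<close>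

definition state_sum ::
  "'a set \<Rightarrow> ('a \<Rightarrow> 'a \<Rightarrow> 'a \<Rightarrow> complex) \<Rightarrow> ('a \<Rightarrow> 'a \<Rightarrow> complex) \<Rightarrow> gluing \<Rightarrow> 'a list \<Rightarrow> complex" where
  "state_sum X C h K xs =
     (\<Sum>c \<in> {c \<in> gl_sides K \<rightarrow>\<^sub>E X. map c (gl_bdry K) = xs}.
        (\<Prod>t \<in> gl_tris K. C (c (t, 0)) (c (t, 1)) (c (t, 2))) *
        (\<Prod>(a, b) \<in> gl_pairs K. h (c a) (c b)))"

text \<open>The common value of the state sums over all triangulations of the surface.\<close>

definition correlation ::
  "'a set \<Rightarrow> ('a \<Rightarrow> 'a \<Rightarrow> 'a \<Rightarrow> complex) \<Rightarrow> ('a \<Rightarrow> 'a \<Rightarrow> complex) \<Rightarrow> nat \<Rightarrow> 'a list \<Rightarrow> complex" where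
  "correlation X C h g xs =
     (THE v. (\<exists>K. triangulates K g (length xs)) \<and>
        (\<forall>K. triangulates K g (length xs) \<longrightarrow> state_sum X C h K xs = v))"

text \<open>Multilinear extension: a linear combination of the symbols \<open>O\<^sub>x\<close> (or of the basis vectors
  \<open>\<phi>\<^sub>x\<close> of the group algebra) is given by its coefficient function on X.\<close>

definition correlation_lin ::
  "'a set \<Rightarrow> ('a \<Rightarrow> 'a \<Rightarrow> 'a \<Rightarrow> complex) \<Rightarrow> ('a \<Rightarrow> 'a \<Rightarrow> complex) \<Rightarrow> nat \<Rightarrow> ('a \<Rightarrow> complex) list \<Rightarrow> complex" where
  "correlation_lin X C h g fs =
     (\<Sum>xs \<in> {xs. set xs \<subseteq> X \<and> length xs = length fs}.
        (\<Prod>i < length fs. (fs ! i) (xs ! i)) * correlation X C h g xs)"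

definition group_C :: "('a, 'b) monoid_scheme \<Rightarrow> 'a \<Rightarrow> 'a \<Rightarrow> 'a \<Rightarrow> complex" where
  "group_C G x y z =
     (if x \<otimes>\<^bsub>G\<^esub> y \<otimes>\<^bsub>G\<^esub> z = \<one>\<^bsub>G\<^esub> then of_nat (card (carrier G)) else 0)"

text \<open>The matrix inverse of \<open>g\<^sub>x\<^sub>y = |G| \<delta>(xy, 1)\<close>.\<close>

definition group_metric_inv :: "('a, 'b) monoid_scheme \<Rightarrow> 'a \<Rightarrow> 'a \<Rightarrow> complex" where
  "group_metric_inv G x y = (if x \<otimes>\<^bsub>G\<^esub> y = \<one>\<^bsub>G\<^esub> then 1 / of_nat (card (carrier G)) else 0)"

definition conjugacy_classes :: "('a, 'b) monoid_scheme \<Rightarrow> 'a set set" where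
  "conjugacy_classes G =
     orbits G (carrier G) (\<lambda>g. \<lambda>x \<in> carrier G. g \<otimes>\<^bsub>G\<^esub> x \<otimes>\<^bsub>G\<^esub> inv\<^bsub>G\<^esub> g)"

text \<open>Coefficients of both \<open>C\<^sub>\<alpha>\<close> (with respect to the \<open>\<phi>\<^sub>x\<close>) and the operator of \<open>\<alpha>\<close> (with respect
  to the \<open>O\<^sub>x\<close>).\<close>

definition class_coeff :: "'a set \<Rightarrow> 'a \<Rightarrow> complex" where
  "class_coeff \<alpha> x = (if x \<in> \<alpha> then complex_of_real (1 / sqrt (real (card \<alpha>))) else 0)"

text \<open>Finite-dimensional complex representations, up to isomorphism: a pair of a degree d and a
  homomorphism to the group of invertible d by d matrices. Values outside the carrier are
  irrelevant and disappear when passing to isomorphism classes.\<close>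

type_synonym 'a rep = "nat \<times> ('a \<Rightarrow> complex mat)"

definition representation :: "('a, 'b) monoid_scheme \<Rightarrow> 'a rep \<Rightarrow> bool" where
  "representation G r \<longleftrightarrow> snd r \<in> hom G (units_of (ring_mat TYPE(complex) (fst r) ()))"

definition irreducible_rep :: "('a, 'b) monoid_scheme \<Rightarrow> 'a rep \<Rightarrow> bool" where
  "irreducible_rep G r \<longleftrightarrow> representation G r \<and> fst r > 0 \<and>
     (\<forall>W. subspace class_ring W (module_vec TYPE(complex) (fst r)) \<and>
          (\<forall>x \<in> carrier G. \<forall>w \<in> W. snd r x *\<^sub>v w \<in> W) \<longrightarrow>
          W = {0\<^sub>v (fst r)} \<or> W = carrier_vec (fst r))"

definition rep_iso :: "('a, 'b) monoid_scheme \<Rightarrow> 'a rep rel" where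
  "rep_iso G = {(r, s). irreducible_rep G r \<and> irreducible_rep G s \<and> fst r = fst s \<and>
     (\<exists>P \<in> carrier_mat (fst r) (fst r). invertible_mat P \<and>
        (\<forall>x \<in> carrier G. P * snd r x = snd s x * P))}"

definition irr_classes :: "('a, 'b) monoid_scheme \<Rightarrow> 'a rep set set" where
  "irr_classes G = {r. irreducible_rep G r} // rep_iso G"

definition rep_character :: "'a rep \<Rightarrow> 'a \<Rightarrow> complex" where
  "rep_character r x = (\<Sum>i < fst r. snd r x $$ (i, i))"

text \<open>Character of an isomorphism class (the trace does not depend on the representative), its
  linear extension to the group algebra, and its degree.\<close>

definition irr_character :: "'a rep set \<Rightarrow> 'a \<Rightarrow> complex" where
  "irr_character j = rep_character (SOME r. r \<in> j)"

definition irr_character_lin :: "('a, 'b) monoid_scheme \<Rightarrow> 'a rep set \<Rightarrow> ('a \<Rightarrow> complex) \<Rightarrow> complex" where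
  "irr_character_lin G j f = (\<Sum>x \<in> carrier G. f x * irr_character j x)"

end

theory Submission
  imports Defs "Jordan_Normal_Form.Spectral_Radius"
begin

text \<open>
  By the decomposition of the regular character, the triangle weight \<open>|G| \<delta>(xyz, 1)\<close> is the sum over
  the irreducible representations \<open>\<rho>\<^sub>j\<close> of \<open>d\<^sub>j tr (\<rho>\<^sub>j(x) \<rho>\<^sub>j(y) \<rho>\<^sub>j(z))\<close>, whose matrix indices sit at the
  corners of the triangle. By Schur orthogonality, summing over the colors of two identified sides
  forces the two representations to agree, identifies the matrix indices at the corners that are
  glued, and contributes \<open>1 / d\<^sub>j\<close>. On a connected surface a single \<open>j\<close> survives; each inner vertex
  carries a free index and gives a factor \<open>d\<^sub>j\<close>, and each boundary loop gives \<open>\<chi>\<^sub>j(x\<^sub>i)\<close>. The exponent of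
  \<open>d\<^sub>j\<close> is thus the Euler characteristic. No classification of surfaces is needed.
\<close>

section \<open>Matrices\<close>

text \<open>\<open>correlation\<close> is a definite description, so it denotes the intended number
  only if each genus and boundary count has some triangulation and all of them give one value.
  Agreement comes for free: evaluating the state sum yields an expression in the genus and the
  colors alone, so no moves between triangulations enter. Existence needs an explicit gluing, which
  is why a polygon model stands next to the representation theory. The count of inner vertices as V
  - n rests on the n boundary loops having n different base vertices. Only then do T triangles and P
  glued pairs combine to the exponent T - P + V - n, which is the Euler characteristic because there
  are P + n edges. A corner is named after the side that starts there. The two indices of a side's
  matrix entry thus sit at its two ends, and gluing sides in opposite directions is exactly the
  crossed index pattern of Schur orthogonality.\<close>

lemma mat_mult_entry:
  assumes "A \<in> carrier_mat n m" "B \<in> carrier_mat m p" "i < n" "j < p"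
  shows "(A * B) $$ (i, j) = (\<Sum>k<m. A $$ (i, k) * B $$ (k, j))"
  using assms by (auto simp: scalar_prod_def atLeast0LessThan)

lemma mat_vec_entry:
  assumes "A \<in> carrier_mat n m" "v \<in> carrier_vec m" "i < n"
  shows "(A *\<^sub>v v) $ i = (\<Sum>k<m. A $$ (i, k) * v $ k)"
  using assms by (auto simp: scalar_prod_def atLeast0LessThan)

lemma mat_eq_if_vec_eq:
  fixes A B :: "'a :: semiring_1 mat"
  assumes "A \<in> carrier_mat n m" "B \<in> carrier_mat n m"
    and "\<And>v. v \<in> carrier_vec m \<Longrightarrow> A *\<^sub>v v = B *\<^sub>v v"
  shows "A = B"
proof (rule eq_matI)
  fix i j assume "i < dim_row B" "j < dim_col B"
  then have ij: "i < n" "j < m" using assms by auto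
  have "A $$ (i, j) = (A *\<^sub>v unit_vec m j) $ i" using assms(1,2) ij by simp
  also have "\<dots> = (B *\<^sub>v unit_vec m j) $ i" using assms(3)[of "unit_vec m j"] by simp
  also have "\<dots> = B $$ (i, j)" using assms(1,2) ij by simp
  finally show "A $$ (i, j) = B $$ (i, j)" .
qed (use assms in auto)

lemma trace_mult_commute:
  fixes A B :: "'a :: comm_semiring_1 mat"
  assumes "A \<in> carrier_mat n m" "B \<in> carrier_mat m n"
  shows "(\<Sum>i<n. (A * B) $$ (i, i)) = (\<Sum>j<m. (B * A) $$ (j, j))"
proof -
  have "(\<Sum>i<n. (A * B) $$ (i, i)) = (\<Sum>i<n. \<Sum>j<m. A $$ (i, j) * B $$ (j, i))"
    using assms by (simp add: mat_mult_entry del: index_mult_mat)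
  also have "\<dots> = (\<Sum>j<m. \<Sum>i<n. B $$ (j, i) * A $$ (i, j))"
    by (subst sum.swap) (simp add: mult.commute)
  also have "\<dots> = (\<Sum>j<m. (B * A) $$ (j, j))"
    using assms by (simp add: mat_mult_entry del: index_mult_mat)
  finally show ?thesis .
qed

lemma invertible_matE:
  assumes "P \<in> carrier_mat n n" "invertible_mat P"
  obtains Q where "Q \<in> carrier_mat n n" "P * Q = 1\<^sub>m n" "Q * P = 1\<^sub>m n"
proof -
  obtain Q where PQ: "P * Q = 1\<^sub>m n" and QP: "Q * P = 1\<^sub>m (dim_row Q)"
    using assms unfolding invertible_mat_def inverts_mat_def by auto
  have "dim_col Q = n" using arg_cong[OF PQ, of dim_col] by simp
  moreover have "dim_row Q = n" using arg_cong[OF QP, of dim_col] assms(1) by simp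
  ultimately show ?thesis using that[of Q] PQ QP by auto
qed

lemma invertible_matI:
  "P \<in> carrier_mat n n \<Longrightarrow> Q \<in> carrier_mat n n \<Longrightarrow> P * Q = 1\<^sub>m n \<Longrightarrow> Q * P = 1\<^sub>m n \<Longrightarrow> invertible_mat P"
  unfolding invertible_mat_def inverts_mat_def by auto

lemma subspace_vec_iff:
  "VectorSpace.subspace class_ring W (module_vec TYPE('a :: field) n) \<longleftrightarrow>
     W \<subseteq> carrier_vec n \<and> 0\<^sub>v n \<in> W \<and> (\<forall>v\<in>W. \<forall>w\<in>W. v + w \<in> W) \<and> (\<forall>c. \<forall>v\<in>W. c \<cdot>\<^sub>v v \<in> W)"
  unfolding VectorSpace.subspace_def submodule_def
  by (auto simp: module_vec_simps vec_module vec_vs)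

text \<open>\<open>E\<close> is the identity with column \<open>i\<close> replaced by
  \<open>u\<close>, and \<open>F\<close> is its inverse in closed form. Multiplication by
  \<open>E\<close> on the right is the exchange step for adapted bases.\<close>

lemma replace_column_inverse:
  fixes u :: "'a :: field vec"
  assumes "u \<in> carrier_vec n" "i < n" "u $ i \<noteq> 0"
  defines "E \<equiv> mat n n (\<lambda>(a, b). if b = i then u $ a else if a = b then 1 else 0)"
    and "F \<equiv> mat n n (\<lambda>(a, b). if b = i then (if a = i then 1 / u $ i else - u $ a / u $ i)
                             else if a = b then 1 else 0)"
  shows "E * F = 1\<^sub>m n" "F * E = 1\<^sub>m n"
proof -
  have c: "E \<in> carrier_mat n n" "F \<in> carrier_mat n n" unfolding E_def F_def by auto
  show "E * F = 1\<^sub>m n"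
  proof (rule eq_matI)
    fix a b assume "a < dim_row (1\<^sub>m n :: 'a mat)" "b < dim_col (1\<^sub>m n :: 'a mat)"
    then have ab: "a < n" "b < n" by auto
    have "(E * F) $$ (a, b) = (\<Sum>k<n. E $$ (a, k) * F $$ (k, b))"
      using c ab by (rule mat_mult_entry)
    \<comment> \<open>Row \<open>a\<close> of \<open>E\<close> can be nonzero only in columns
      \<open>i\<close> and \<open>a\<close>, so at most two terms survive.\<close>
    also have "\<dots> = E $$ (a, i) * F $$ (i, b) + (\<Sum>k\<in>{..<n} - {i}. E $$ (a, k) * F $$ (k, b))"
      using assms(2) by (subst sum.remove[of _ i]) auto
    also have "(\<Sum>k\<in>{..<n} - {i}. E $$ (a, k) * F $$ (k, b)) =
               (\<Sum>k\<in>{..<n} - {i}. if k = a then F $$ (a, b) else 0)"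
      using ab by (intro sum.cong) (auto simp: E_def)
    also have "\<dots> = (if a \<noteq> i then F $$ (a, b) else 0)"
      using ab by (subst sum.delta) auto
    also have "E $$ (a, i) * F $$ (i, b) + \<dots> = 1\<^sub>m n $$ (a, b)"
      using ab assms(2,3) by (auto simp: E_def F_def)
    finally show "(E * F) $$ (a, b) = 1\<^sub>m n $$ (a, b)" .
  qed (use c in auto)
  then show "F * E = 1\<^sub>m n" using c mat_mult_left_right_inverse by blast
qed

text \<open>Among all invertible \<open>P\<close> take one with as many columns in \<open>W\<close>
  as possible, \<open>I\<close> indexing such columns. A vector of \<open>W\<close> with a nonzero
  coordinate outside \<open>I\<close> could replace the column of that index, contradicting
  maximality.\<close>

lemma adapted_basis:
  fixes W :: "'a :: field vec set"
  assumes W: "VectorSpace.subspace class_ring W (module_vec TYPE('a) n)"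
  obtains I P Q where "I \<subseteq> {..<n}" "P \<in> carrier_mat n n" "Q \<in> carrier_mat n n"
    "P * Q = 1\<^sub>m n" "Q * P = 1\<^sub>m n"
    "\<And>v. v \<in> carrier_vec n \<Longrightarrow> v \<in> W \<longleftrightarrow> (\<forall>i\<in>{..<n} - I. (Q *\<^sub>v v) $ i = 0)"
proof -
  have sub: "W \<subseteq> carrier_vec n" and zero: "0\<^sub>v n \<in> W"
    and add: "\<And>v w. v \<in> W \<Longrightarrow> w \<in> W \<Longrightarrow> v + w \<in> W"
    and smult: "\<And>c v. v \<in> W \<Longrightarrow> c \<cdot>\<^sub>v v \<in> W"
    using W unfolding subspace_vec_iff by auto
  define good where "good = (\<lambda>k. \<exists>I P Q. card I = k \<and> I \<subseteq> {..<n} \<and> P \<in> carrier_mat n n \<and>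
    Q \<in> carrier_mat n n \<and> P * Q = 1\<^sub>m n \<and> Q * P = 1\<^sub>m n \<and> (\<forall>j\<in>I. col P j \<in> W))"
  have "good 0" unfolding good_def
    by (rule exI[of _ "{}"], rule exI[of _ "1\<^sub>m n"], rule exI[of _ "1\<^sub>m n"]) auto
  moreover have bound: "good k \<Longrightarrow> k \<le> n" for k
    unfolding good_def using card_mono[of "{..<n}"] by force
  ultimately have max: "good (GREATEST k. good k)" "\<And>k. good k \<Longrightarrow> k \<le> (GREATEST k. good k)"
    using GreatestI_nat[of good] Greatest_le_nat[of good] by blast+
  obtain I P Q where I: "card I = (GREATEST k. good k)" "I \<subseteq> {..<n}"
    and P: "P \<in> carrier_mat n n" "Q \<in> carrier_mat n n" "P * Q = 1\<^sub>m n" "Q * P = 1\<^sub>m n"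
    and cols: "\<And>j. j \<in> I \<Longrightarrow> col P j \<in> W"
    using max(1) unfolding good_def by blast
  have finI: "finite I" using I(2) finite_subset by blast
  have "v \<in> W \<longleftrightarrow> (\<forall>i\<in>{..<n} - I. (Q *\<^sub>v v) $ i = 0)" if v: "v \<in> carrier_vec n" for v
  proof
    define u where "u = Q *\<^sub>v v"
    have u: "u \<in> carrier_vec n" using P v unfolding u_def by auto
    have Pu: "P *\<^sub>v u = v" unfolding u_def using P v by (simp flip: assoc_mult_mat_vec)
    {
      assume vW: "v \<in> W"
      show "\<forall>i\<in>{..<n} - I. (Q *\<^sub>v v) $ i = 0"
      proof (rule ccontr)
        assume "\<not> ?thesis"
        then obtain i where i: "i < n" "i \<notin> I" "u $ i \<noteq> 0" unfolding u_def by auto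
        \<comment> \<open>Since \<open>P\<close> maps \<open>u\<close> to \<open>v\<close>, column
          \<open>i\<close> of \<open>P * E\<close> is \<open>v\<close>, while the other columns are
          those of \<open>P\<close>.\<close>
        define E where "E = mat n n (\<lambda>(a, b). if b = i then u $ a else if a = b then 1 else 0)"
        define F where "F = mat n n (\<lambda>(a, b). if b = i then (if a = i then 1 / u $ i else - u $ a / u $ i)
                             else if a = b then 1 else 0)"
        have EF: "E * F = 1\<^sub>m n" "F * E = 1\<^sub>m n"
          using replace_column_inverse[OF u i(1) i(3)] unfolding E_def F_def by auto
        have c: "E \<in> carrier_mat n n" "F \<in> carrier_mat n n" unfolding E_def F_def by auto
        have "(P * E) * (F * Q) = P * (E * F) * Q"
          using c P(1,2) by (simp add: assoc_mult_mat[of _ n n _ n _ n])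
        then have 1: "(P * E) * (F * Q) = 1\<^sub>m n" using EF P by simp
        have "(F * Q) * (P * E) = F * (Q * P) * E"
          using c P(1,2) by (simp add: assoc_mult_mat[of _ n n _ n _ n])
        then have 2: "(F * Q) * (P * E) = 1\<^sub>m n" using EF P c by simp
        have 3: "col (P * E) j \<in> W" if j: "j \<in> insert i I" for j
        proof -
          have jn: "j < n" using j i I by auto
          have colP: "col (P * E) j = P *\<^sub>v col E j"
            using c P jn by (metis carrier_matD(2) col_mult2)
          show ?thesis
          proof (cases "j = i")
            case True
            then have "col E j = u" using u i unfolding E_def by (intro eq_vecI) auto
            then show ?thesis using colP Pu vW by simp
          next
            case False
            then have "col E j = unit_vec n j" using jn unfolding E_def by (intro eq_vecI) auto
            moreover have "P *\<^sub>v unit_vec n j = col P j"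
              using P jn by (intro eq_vecI) auto
            ultimately show ?thesis using colP cols[of j] j False by auto
          qed
        qed
        have "good (card (insert i I))" unfolding good_def
          by (rule exI[of _ "insert i I"], rule exI[of _ "P * E"], rule exI[of _ "F * Q"])
            (use 1 2 3 I i c P in auto)
        from max(2)[OF this] show False using i finI I(1) by simp
      qed
    }
    {
      assume z: "\<forall>i\<in>{..<n} - I. (Q *\<^sub>v v) $ i = 0"
      \<comment> \<open>The partial sums of the expansion of \<open>v\<close> in the columns of
        \<open>P\<close> stay in \<open>W\<close>; induction over \<open>J\<close> takes the place
        of a span operator.\<close>
      have "vec n (\<lambda>a. \<Sum>j\<in>J. P $$ (a, j) * u $ j) \<in> W" if "J \<subseteq> I" for J
        using finite_subset[OF that finI] that
      proof (induction J rule: finite_induct)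
        case empty
        have "vec n (\<lambda>a. \<Sum>j\<in>{}. P $$ (a, j) * u $ j) = 0\<^sub>v n" by (intro eq_vecI) auto
        then show ?case using zero by simp
      next
        case (insert j J)
        then have "j < n" using I by auto
        then have "vec n (\<lambda>a. \<Sum>j\<in>insert j J. P $$ (a, j) * u $ j) =
              u $ j \<cdot>\<^sub>v col P j + vec n (\<lambda>a. \<Sum>j\<in>J. P $$ (a, j) * u $ j)"
          using insert P by (intro eq_vecI) (auto simp: algebra_simps)
        then show ?case using add smult cols insert by auto
      qed
      from this[of I] have "vec n (\<lambda>a. \<Sum>j\<in>I. P $$ (a, j) * u $ j) \<in> W" by simp
      also have "vec n (\<lambda>a. \<Sum>j\<in>I. P $$ (a, j) * u $ j) = v"
      proof (rule eq_vecI)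
        fix a assume "a < dim_vec v"
        then have a: "a < n" using v by auto
        have "v $ a = (\<Sum>j<n. P $$ (a, j) * u $ j)"
          using mat_vec_entry[OF P(1) u a] Pu by simp
        also have "\<dots> = (\<Sum>j\<in>I. P $$ (a, j) * u $ j)"
          using I z unfolding u_def by (intro sum.mono_neutral_right) auto
        finally show "vec n (\<lambda>a. \<Sum>j\<in>I. P $$ (a, j) * u $ j) $ a = v $ a" using a by simp
      qed (use v in auto)
      finally show "v \<in> W" .
    }
  qed
  with I P show ?thesis using that by blast
qed

section \<open>Characters of a finite group\<close>

locale finite_grp = group G for G (structure) +
  assumes finite_carrier: "finite (carrier G)"
begin

text \<open>Invertibility is hidden in the condition at \<open>\<one>\<close>: with multiplicativity
  it makes \<open>snd r (inv x)\<close> a two-sided inverse of \<open>snd r x\<close>.\<close>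

lemma representation_iff:
  "representation G r \<longleftrightarrow>
     (\<forall>x\<in>carrier G. snd r x \<in> carrier_mat (fst r) (fst r)) \<and>
     (\<forall>x\<in>carrier G. \<forall>y\<in>carrier G. snd r (x \<otimes> y) = snd r x * snd r y) \<and>
     snd r \<one> = 1\<^sub>m (fst r)" (is "_ \<longleftrightarrow> ?R")
proof
  let ?M = "ring_mat TYPE(complex) (fst r) ()"
  interpret M: ring ?M by (rule ring_mat)
  assume "representation G r"
  then have h: "snd r \<in> hom G (units_of ?M)" unfolding representation_def .
  then interpret group_hom G "units_of ?M" "snd r"
    by (intro group_hom.intro is_group M.units_group group_hom_axioms.intro)
  have "snd r x \<in> carrier_mat (fst r) (fst r)" if "x \<in> carrier G" for x
    using hom_closed[OF that] by (auto simp: units_of_def Units_def ring_mat_simps)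
  moreover have "snd r (x \<otimes> y) = snd r x * snd r y" if "x \<in> carrier G" "y \<in> carrier G" for x y
    using hom_mult[OF that] by (simp add: units_of_def ring_mat_simps)
  moreover have "snd r \<one> = 1\<^sub>m (fst r)"
    using hom_one by (simp add: units_of_def ring_mat_simps)
  ultimately show ?R by blast
next
  assume R: ?R
  show "representation G r" unfolding representation_def
  proof (rule homI)
    fix x assume x: "x \<in> carrier G"
    have "snd r x * snd r (inv x) = 1\<^sub>m (fst r)" "snd r (inv x) * snd r x = 1\<^sub>m (fst r)"
      using R x by (metis inv_closed r_inv l_inv)+
    then show "snd r x \<in> carrier (units_of (ring_mat TYPE(complex) (fst r) ()))"
      using R x inv_closed[OF x]
      by (auto simp: units_of_def Units_def ring_mat_simps intro!: bexI[of _ "snd r (inv x)"])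
  next
    fix x y assume "x \<in> carrier G" "y \<in> carrier G"
    then show "snd r (x \<otimes> y) = snd r x \<otimes>\<^bsub>units_of (ring_mat TYPE(complex) (fst r) ())\<^esub> snd r y"
      using R by (simp add: units_of_def ring_mat_simps)
  qed
qed

lemma
  assumes "representation G r"
  shows rep_carrier: "x \<in> carrier G \<Longrightarrow> snd r x \<in> carrier_mat (fst r) (fst r)"
    and rep_mult: "x \<in> carrier G \<Longrightarrow> y \<in> carrier G \<Longrightarrow> snd r (x \<otimes> y) = snd r x * snd r y"
    and rep_one: "snd r \<one> = 1\<^sub>m (fst r)"
  using assms unfolding representation_iff by auto

lemma rep_mult_entry:
  assumes "representation G r" "x \<in> carrier G" "y \<in> carrier G" "i < fst r" "j < fst r"
  shows "snd r (x \<otimes> y) $$ (i, j) = (\<Sum>k<fst r. snd r x $$ (i, k) * snd r y $$ (k, j))"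
  using assms mat_mult_entry[of "snd r x" "fst r" "fst r" "snd r y" "fst r" i j]
  by (simp add: rep_mult rep_carrier del: index_mult_mat)

lemma irreducible_repD:
  assumes "irreducible_rep G r"
  shows "representation G r" "fst r > 0"
    "\<And>W. VectorSpace.subspace class_ring W (module_vec TYPE(complex) (fst r)) \<Longrightarrow>
      (\<And>x w. x \<in> carrier G \<Longrightarrow> w \<in> W \<Longrightarrow> snd r x *\<^sub>v w \<in> W) \<Longrightarrow>
      W = {0\<^sub>v (fst r)} \<or> W = carrier_vec (fst r)"
  using assms unfolding irreducible_rep_def by blast+

section \<open>Schur's lemma and orthogonality of matrix entries\<close>

text \<open>Kernel and image of the intertwiner \<open>T\<close> are invariant subspaces, so
  irreducibility leaves a trivial kernel and a full image. It remains to turn this into an inverse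
  of a matrix not yet known to be square.\<close>

lemma schur:
  assumes r: "irreducible_rep G r" and s: "irreducible_rep G s"
    and T: "T \<in> carrier_mat (fst r) (fst s)" "T \<noteq> 0\<^sub>m (fst r) (fst s)"
    and comm: "\<And>x. x \<in> carrier G \<Longrightarrow> snd r x * T = T * snd s x"
  shows "fst r = fst s \<and> invertible_mat T"
proof -
  note R = irreducible_repD[OF r] and S = irreducible_repD[OF s]
  have comm': "T *\<^sub>v (snd s x *\<^sub>v v) = snd r x *\<^sub>v (T *\<^sub>v v)"
    if "x \<in> carrier G" "v \<in> carrier_vec (fst s)" for x v
    using comm[OF that(1)] T(1) rep_carrier[OF R(1) that(1)] rep_carrier[OF S(1) that(1)] that(2)
    by (metis assoc_mult_mat_vec)
  define K where "K = {v \<in> carrier_vec (fst s). T *\<^sub>v v = 0\<^sub>v (fst r)}"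
  have "K = {0\<^sub>v (fst s)} \<or> K = carrier_vec (fst s)"
  proof (rule S(3))
    show "VectorSpace.subspace class_ring K (module_vec TYPE(complex) (fst s))"
      using T(1) unfolding subspace_vec_iff K_def
      by (auto simp: mult_add_distrib_mat_vec mult_mat_vec)
    show "snd s x *\<^sub>v w \<in> K" if "x \<in> carrier G" "w \<in> K" for x w
      using that comm'[of x w] rep_carrier[OF R(1) that(1)] rep_carrier[OF S(1) that(1)]
      unfolding K_def by auto
  qed
  moreover have "K \<noteq> carrier_vec (fst s)"
  proof
    assume "K = carrier_vec (fst s)"
    then have "T *\<^sub>v v = 0\<^sub>m (fst r) (fst s) *\<^sub>v v" if "v \<in> carrier_vec (fst s)" for v
    proof -
      have "T *\<^sub>v v = 0\<^sub>v (fst r)" using that \<open>K = carrier_vec (fst s)\<close> unfolding K_def by blast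
      then show ?thesis using that by (intro eq_vecI) auto
    qed
    then show False using T mat_eq_if_vec_eq[of T _ _ "0\<^sub>m (fst r) (fst s)"] by auto
  qed
  ultimately have inj: "v = 0\<^sub>v (fst s)" if "v \<in> carrier_vec (fst s)" "T *\<^sub>v v = 0\<^sub>v (fst r)" for v
    using that unfolding K_def by blast
  define I where "I = (\<lambda>v. T *\<^sub>v v) ` carrier_vec (fst s)"
  have "I = {0\<^sub>v (fst r)} \<or> I = carrier_vec (fst r)"
  proof (rule R(3))
    show "VectorSpace.subspace class_ring I (module_vec TYPE(complex) (fst r))"
      unfolding subspace_vec_iff
    proof (intro conjI allI ballI)
      show "I \<subseteq> carrier_vec (fst r)" using T unfolding I_def by auto
      have "T *\<^sub>v 0\<^sub>v (fst s) = 0\<^sub>v (fst r)" using T by auto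
      then show "0\<^sub>v (fst r) \<in> I" unfolding I_def by (metis imageI zero_carrier_vec)
      show "v + w \<in> I" if "v \<in> I" "w \<in> I" for v w
        using that T(1) unfolding I_def by (auto simp flip: mult_add_distrib_mat_vec)
      show "c \<cdot>\<^sub>v v \<in> I" if "v \<in> I" for c v
        using that T(1) unfolding I_def by (auto simp flip: mult_mat_vec)
    qed
    show "snd r x *\<^sub>v w \<in> I" if "x \<in> carrier G" "w \<in> I" for x w
      using that rep_carrier[OF S(1) that(1)] unfolding I_def by (auto simp flip: comm')
  qed
  moreover have "I \<noteq> {0\<^sub>v (fst r)}"
  proof
    assume "I = {0\<^sub>v (fst r)}"
    moreover have "T *\<^sub>v unit_vec (fst s) 0 \<in> I" unfolding I_def by auto
    ultimately have "unit_vec (fst s) 0 = (0\<^sub>v (fst s) :: complex vec)" using inj by auto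
    then show False using S(2) by simp
  qed
  ultimately have "I = carrier_vec (fst r)" by blast
  then have "\<exists>v \<in> carrier_vec (fst s). T *\<^sub>v v = w" if "w \<in> carrier_vec (fst r)" for w
    using that unfolding I_def by (metis imageE)
  then obtain f where f: "\<And>w. w \<in> carrier_vec (fst r) \<Longrightarrow> f w \<in> carrier_vec (fst s) \<and> T *\<^sub>v f w = w"
    by metis
  \<comment> \<open>The columns of \<open>U\<close> are preimages of the unit vectors. This makes
    \<open>U\<close> a right inverse, and injectivity of \<open>T\<close> makes it a left inverse
    too.\<close>
  define U where "U = mat (fst s) (fst r) (\<lambda>(k, i). f (unit_vec (fst r) i) $ k)"
  have U: "U \<in> carrier_mat (fst s) (fst r)" unfolding U_def by auto
  have TU: "T * U = 1\<^sub>m (fst r)"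
  proof (rule eq_matI)
    fix i j assume "i < dim_row (1\<^sub>m (fst r) :: complex mat)" "j < dim_col (1\<^sub>m (fst r) :: complex mat)"
    then have ij: "i < fst r" "j < fst r" by auto
    have "col U j = f (unit_vec (fst r) j)"
      using f[of "unit_vec (fst r) j"] ij unfolding U_def by (intro eq_vecI) auto
    then have "col (T * U) j = unit_vec (fst r) j"
      using f[of "unit_vec (fst r) j"] col_mult2[OF T(1) U ij(2)] by simp
    then have "col (T * U) j $ i = unit_vec (fst r) j $ i" by simp
    then show "(T * U) $$ (i, j) = 1\<^sub>m (fst r) $$ (i, j)"
      using ij T(1) U by (auto simp: unit_vec_def)
  qed (use T U in auto)
  have UT: "U * T = 1\<^sub>m (fst s)"
  proof (rule mat_eq_if_vec_eq)
    fix v :: "complex vec" assume v: "v \<in> carrier_vec (fst s)"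
    let ?w = "(U * T) *\<^sub>v v - v"
    have UTv: "(U * T) *\<^sub>v v \<in> carrier_vec (fst s)" using U T(1) v by auto
    have "T *\<^sub>v ((U * T) *\<^sub>v v) = (T * U) *\<^sub>v (T *\<^sub>v v)"
      using U T(1) v by (simp add: assoc_mult_mat_vec[of _ _ "fst s"] assoc_mult_mat_vec[of _ _ "fst r"])
    also have "\<dots> = T *\<^sub>v v" using TU T(1) v by simp
    finally have "T *\<^sub>v ?w = 0\<^sub>v (fst r)"
      using UTv v T(1) by (simp add: mult_minus_distrib_mat_vec[OF T(1)] minus_cancel_vec)
    then have w0: "?w = 0\<^sub>v (fst s)" using inj[of ?w] UTv v by auto
    have "((U * T) *\<^sub>v v) $ k = v $ k" if "k < fst s" for k
      using arg_cong[OF w0, of "\<lambda>w. w $ k"] that UTv v by auto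
    then show "(U * T) *\<^sub>v v = 1\<^sub>m (fst s) *\<^sub>v v"
      using UTv v U by (intro eq_vecI) auto
  qed (use T U in auto)
  \<comment> \<open>Both products are identity matrices, so comparing their traces, in
    characteristic zero, gives equal degrees.\<close>
  have "of_nat (fst r) = (\<Sum>i<fst r. (T * U) $$ (i, i))" unfolding TU by simp
  also have "\<dots> = (\<Sum>i<fst s. (U * T) $$ (i, i))" by (rule trace_mult_commute[OF T(1) U])
  also have "\<dots> = of_nat (fst s)" unfolding UT by simp
  finally have "fst r = fst s" by (simp only: of_nat_eq_iff)
  moreover have "invertible_mat T"
    using T(1) U TU UT \<open>fst r = fst s\<close> by (auto intro: invertible_matI)
  ultimately show ?thesis ..
qed

text \<open>Over the complex numbers \<open>T\<close> has an eigenvalue \<open>c\<close>. Then T - c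
  still commutes with the representation but kills an eigenvector, so it is not invertible and must
  be zero by Schur's lemma.\<close>

lemma schur_endo:
  assumes r: "irreducible_rep G r" and T: "T \<in> carrier_mat (fst r) (fst r)"
    and comm: "\<And>x. x \<in> carrier G \<Longrightarrow> snd r x * T = T * snd r x"
  obtains c where "T = c \<cdot>\<^sub>m 1\<^sub>m (fst r)"
proof -
  note R = irreducible_repD[OF r]
  obtain c where "eigenvalue T c" using spectrum_non_empty[OF T R(2)] unfolding spectrum_def by auto
  then obtain v where v: "v \<in> carrier_vec (fst r)" "v \<noteq> 0\<^sub>v (fst r)" "T *\<^sub>v v = c \<cdot>\<^sub>v v"
    unfolding eigenvalue_def eigenvector_def using T by auto
  define S where "S = T - c \<cdot>\<^sub>m 1\<^sub>m (fst r)"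
  have S: "S \<in> carrier_mat (fst r) (fst r)" using T unfolding S_def by auto
  have commS: "snd r x * S = S * snd r x" if "x \<in> carrier G" for x
    using comm[OF that] T rep_carrier[OF R(1) that] unfolding S_def
    by (simp add: mult_minus_distrib_mat[of _ "fst r" "fst r"] minus_mult_distrib_mat[of _ "fst r" "fst r"]
        mult_smult_distrib[of "snd r x" "fst r" "fst r" "1\<^sub>m (fst r)" "fst r"] mult_smult_assoc_mat[of _ "fst r" "fst r"])
  have Sv: "S *\<^sub>v v = 0\<^sub>v (fst r)"
    using v T unfolding S_def by (auto simp: minus_mult_distrib_mat_vec[of _ "fst r" "fst r"])
  have "S = 0\<^sub>m (fst r) (fst r)"
  proof (rule ccontr)
    assume "S \<noteq> 0\<^sub>m (fst r) (fst r)"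
    then have "invertible_mat S" using schur[OF r r S _ commS] by auto
    then obtain U where U: "U \<in> carrier_mat (fst r) (fst r)" "U * S = 1\<^sub>m (fst r)"
      using invertible_matE[OF S] by blast
    have "v = U *\<^sub>v (S *\<^sub>v v)" using assoc_mult_mat_vec[OF U(1) S v(1)] U v by simp
    then show False using Sv U v by auto
  qed
  then have "T $$ (i, j) = c * 1\<^sub>m (fst r) $$ (i, j)" if "i < fst r" "j < fst r" for i j
  proof -
    have "S $$ (i, j) = 0" using \<open>S = 0\<^sub>m (fst r) (fst r)\<close> that by simp
    then show ?thesis using that T unfolding S_def by simp
  qed
  then have "T = c \<cdot>\<^sub>m 1\<^sub>m (fst r)" using T by (intro eq_matI) auto
  then show ?thesis using that by blast
qed

lemma sum_left_translate:
  "y \<in> carrier G \<Longrightarrow> (\<Sum>x\<in>carrier G. f (y \<otimes> x)) = (\<Sum>x\<in>carrier G. f x)"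
  by (rule sum.reindex_bij_witness[of _ "\<lambda>x. inv y \<otimes> x" "\<lambda>x. y \<otimes> x"])
    (auto simp: m_assoc[symmetric])

text \<open>\<open>T\<close> is the sum over \<open>x\<close> of r(x) E s(x^-1), where E is the
  matrix unit at \<open>(b, c)\<close>. Translating the summation variable moves \<open>y\<close>
  from the left to the right.\<close>

lemma average_intertwines:
  fixes b c
  assumes r: "representation G r" and s: "representation G s" and bc: "b < fst r" "c < fst s"
    and y: "y \<in> carrier G"
  defines "T \<equiv> mat (fst r) (fst s) (\<lambda>(i, j). \<Sum>x\<in>carrier G. snd r x $$ (i, b) * snd s (inv x) $$ (c, j))"
  shows "snd r y * T = T * snd s y"
proof (rule eq_matI)
  have T: "T \<in> carrier_mat (fst r) (fst s)" unfolding T_def by auto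
  note cr = rep_carrier[OF r y] and cs = rep_carrier[OF s y]
  fix i j assume "i < dim_row (T * snd s y)" "j < dim_col (T * snd s y)"
  then have ij: "i < fst r" "j < fst s" using T cs by auto
  have "(snd r y * T) $$ (i, j) =
      (\<Sum>k<fst r. snd r y $$ (i, k) * (\<Sum>x\<in>carrier G. snd r x $$ (k, b) * snd s (inv x) $$ (c, j)))"
    using ij by (subst mat_mult_entry[OF cr T ij]) (simp add: T_def)
  also have "\<dots> = (\<Sum>x\<in>carrier G. (\<Sum>k<fst r. snd r y $$ (i, k) * snd r x $$ (k, b)) * snd s (inv x) $$ (c, j))"
    by (simp add: sum_distrib_left sum_distrib_right mult.assoc sum.swap[of _ "carrier G"])
  also have "\<dots> = (\<Sum>x\<in>carrier G. snd r (y \<otimes> x) $$ (i, b) * snd s (inv x) $$ (c, j))"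
    using rep_mult_entry[OF r y _ ij(1) bc(1)] by (intro sum.cong) auto
  \<comment> \<open>Writing x^-1 as (yx)^-1 y turns the summand into a function of
    \<open>y \<otimes> x\<close>.\<close>
  also have "\<dots> = (\<Sum>x\<in>carrier G. snd r (y \<otimes> x) $$ (i, b) * snd s (inv (y \<otimes> x) \<otimes> y) $$ (c, j))"
    using y by (intro sum.cong) (auto simp: inv_mult_group m_assoc)
  also have "\<dots> = (\<Sum>x\<in>carrier G. snd r x $$ (i, b) * snd s (inv x \<otimes> y) $$ (c, j))"
    by (rule sum_left_translate[OF y])
  also have "\<dots> = (\<Sum>x\<in>carrier G. \<Sum>k<fst s. snd r x $$ (i, b) * (snd s (inv x) $$ (c, k) * snd s y $$ (k, j)))"
    using rep_mult_entry[OF s _ y bc(2) ij(2)] by (intro sum.cong) (auto simp: sum_distrib_left)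
  also have "\<dots> = (\<Sum>k<fst s. (\<Sum>x\<in>carrier G. snd r x $$ (i, b) * snd s (inv x) $$ (c, k)) * snd s y $$ (k, j))"
    by (subst sum.swap) (simp add: sum_distrib_right mult.assoc)
  also have "\<dots> = (T * snd s y) $$ (i, j)"
    using ij by (subst mat_mult_entry[OF T cs ij]) (simp add: T_def)
  finally show "(snd r y * T) $$ (i, j) = (T * snd s y) $$ (i, j)" .
qed (use rep_carrier[OF r y] rep_carrier[OF s y] in \<open>auto simp: T_def\<close>)

text \<open>The sum is entry \<open>(a, d)\<close> of the averaged intertwiner from \<open>s\<close>
  to \<open>r\<close>, which Schur's lemma forces to vanish; hence the order \<open>(s, r)\<close>
  in the hypothesis.\<close>

lemma orthogonality_not_iso:
  assumes r: "irreducible_rep G r" and s: "irreducible_rep G s" and "(s, r) \<notin> rep_iso G"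
    and "a < fst r" "b < fst r" "c < fst s" "d < fst s"
  shows "(\<Sum>x\<in>carrier G. snd r x $$ (a, b) * snd s (inv x) $$ (c, d)) = 0"
proof -
  define T where "T = mat (fst r) (fst s)
      (\<lambda>(i, j). \<Sum>x\<in>carrier G. snd r x $$ (i, b) * snd s (inv x) $$ (c, j))"
  have T: "T \<in> carrier_mat (fst r) (fst s)" unfolding T_def by auto
  have comm: "snd r y * T = T * snd s y" if "y \<in> carrier G" for y
    unfolding T_def using average_intertwines[OF irreducible_repD(1)[OF r] irreducible_repD(1)[OF s]] assms that
    by blast
  have "T = 0\<^sub>m (fst r) (fst s)"
  proof (rule ccontr)
    assume "T \<noteq> 0\<^sub>m (fst r) (fst s)"
    then have "fst r = fst s" "invertible_mat T" using schur[OF r s T _ comm] by auto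
    then have "(s, r) \<in> rep_iso G" using r s T comm unfolding rep_iso_def by auto
    then show False using assms by simp
  qed
  then have "T $$ (a, d) = 0" using assms by simp
  then show ?thesis using assms unfolding T_def by simp
qed

text \<open>Now the averaged intertwiner is a scalar \<open>k\<close>, found from its trace: summing
  over the outer index leaves, for each group element, the entry \<open>(c, b)\<close> of r(x^-1 x),
  hence of the identity.\<close>

lemma orthogonality_same:
  assumes r: "irreducible_rep G r"
    and "a < fst r" "b < fst r" "c < fst r" "d < fst r"
  shows "(\<Sum>x\<in>carrier G. snd r x $$ (a, b) * snd r (inv x) $$ (c, d)) =
     (if a = d \<and> b = c then of_nat (card (carrier G)) / of_nat (fst r) else 0)"
proof -
  note R = irreducible_repD[OF r]
  define T where "T = mat (fst r) (fst r)
      (\<lambda>(i, j). \<Sum>x\<in>carrier G. snd r x $$ (i, b) * snd r (inv x) $$ (c, j))"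
  have T: "T \<in> carrier_mat (fst r) (fst r)" unfolding T_def by auto
  have comm: "snd r y * T = T * snd r y" if "y \<in> carrier G" for y
    unfolding T_def using average_intertwines[OF R(1) R(1)] assms that by blast
  obtain k where k: "T = k \<cdot>\<^sub>m 1\<^sub>m (fst r)" using schur_endo[OF r T comm] .
  have "of_nat (fst r) * k = (\<Sum>i<fst r. T $$ (i, i))" unfolding k by simp
  also have "\<dots> = (\<Sum>x\<in>carrier G. \<Sum>i<fst r. snd r (inv x) $$ (c, i) * snd r x $$ (i, b))"
    by (subst sum.swap) (simp add: T_def mult.commute)
  also have "\<dots> = (\<Sum>x\<in>carrier G. 1\<^sub>m (fst r) $$ (c, b))"
    using rep_mult_entry[OF R(1) _ _ assms(4,3)] rep_one[OF R(1)]
    by (intro sum.cong) (auto simp flip: rep_mult_entry[OF R(1) _ _ assms(4,3)] simp del: index_one_mat)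
  also have "\<dots> = (if b = c then of_nat (card (carrier G)) else 0)"
    using assms by auto
  finally have "k = (if b = c then of_nat (card (carrier G)) / of_nat (fst r) else 0)"
    using R(2) by (auto simp: field_simps split: if_splits)
  moreover have "T $$ (a, d) = (if a = d then k else 0)" using assms by (simp add: k)
  ultimately show ?thesis using assms unfolding T_def by (auto split: if_splits)
qed

section \<open>Isomorphism classes and orthogonality of characters\<close>

lemma rep_character_iso:
  assumes "(r, s) \<in> rep_iso G" "x \<in> carrier G"
  shows "rep_character r x = rep_character s x"
proof -
  from assms(1) obtain P where rs: "irreducible_rep G r" "irreducible_rep G s" and d: "fst r = fst s"
    and P: "P \<in> carrier_mat (fst r) (fst r)" "invertible_mat P"
    and comm: "\<And>x. x \<in> carrier G \<Longrightarrow> P * snd r x = snd s x * P"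
    unfolding rep_iso_def by auto
  obtain Q where Q: "Q \<in> carrier_mat (fst r) (fst r)" "P * Q = 1\<^sub>m (fst r)" "Q * P = 1\<^sub>m (fst r)"
    using invertible_matE[OF P] .
  note cr = rep_carrier[OF irreducible_repD(1)[OF rs(1)] assms(2)]
  note cs = rep_carrier[OF irreducible_repD(1)[OF rs(2)] assms(2), folded d]
  have "rep_character r x = (\<Sum>i<fst r. ((Q * P) * snd r x) $$ (i, i))"
    using Q cr by (simp add: rep_character_def del: index_mult_mat)
  also have "(Q * P) * snd r x = Q * (snd s x * P)"
    using assoc_mult_mat[OF Q(1) P(1) cr] comm[OF assms(2)] by simp
  also have "(\<Sum>i<fst r. (Q * (snd s x * P)) $$ (i, i)) = (\<Sum>i<fst r. ((snd s x * P) * Q) $$ (i, i))"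
    by (rule trace_mult_commute) (use Q P cs in auto)
  also have "(snd s x * P) * Q = snd s x * (P * Q)"
    by (rule assoc_mult_mat[OF cs P(1) Q(1)])
  also have "(\<Sum>i<fst r. (snd s x * (P * Q)) $$ (i, i)) = rep_character s x"
    using Q cs by (simp add: rep_character_def d del: index_mult_mat)
  finally show ?thesis .
qed

lemma rep_iso_equiv: "equiv {r. irreducible_rep G r} (rep_iso G)"
proof (rule equivI)
  show "rep_iso G \<subseteq> {r. irreducible_rep G r} \<times> {r. irreducible_rep G r}" unfolding rep_iso_def by auto
  show "refl_on {r. irreducible_rep G r} (rep_iso G)"
  proof (rule refl_onI)
    fix r assume "r \<in> {r. irreducible_rep G r}"
    then have r: "irreducible_rep G r" by simp
    have "1\<^sub>m (fst r) * snd r x = snd r x * 1\<^sub>m (fst r)" if "x \<in> carrier G" for x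
      using rep_carrier[OF irreducible_repD(1)[OF r] that] by auto
    moreover have "invertible_mat (1\<^sub>m (fst r) :: complex mat)"
      by (auto intro: invertible_matI[of _ "fst r" "1\<^sub>m (fst r)"])
    ultimately show "(r, r) \<in> rep_iso G"
      using r unfolding rep_iso_def by (auto intro!: bexI[of _ "1\<^sub>m (fst r)"])
  qed
  show "sym (rep_iso G)"
  proof (rule symI)
    fix r s assume "(r, s) \<in> rep_iso G"
    then obtain P where rs: "irreducible_rep G r" "irreducible_rep G s" and d: "fst r = fst s"
      and P: "P \<in> carrier_mat (fst r) (fst r)" "invertible_mat P"
      and comm: "\<And>x. x \<in> carrier G \<Longrightarrow> P * snd r x = snd s x * P"
      unfolding rep_iso_def by auto
    obtain Q where Q: "Q \<in> carrier_mat (fst r) (fst r)" "P * Q = 1\<^sub>m (fst r)" "Q * P = 1\<^sub>m (fst r)"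
      using invertible_matE[OF P] .
    have "Q * snd s x = snd r x * Q" if x: "x \<in> carrier G" for x
    proof -
      note cr = rep_carrier[OF irreducible_repD(1)[OF rs(1)] x]
      note cs = rep_carrier[OF irreducible_repD(1)[OF rs(2)] x, folded d]
      have "Q * snd s x = Q * (snd s x * (P * Q))" using Q cs by simp
      also have "\<dots> = Q * (snd s x * P) * Q"
        using Q(1) P cs by (simp add: assoc_mult_mat[of _ "fst r" "fst r" _ "fst r" _ "fst r"])
      also have "\<dots> = Q * (P * snd r x) * Q" using comm[OF x] by simp
      also have "\<dots> = (Q * P) * snd r x * Q"
        using Q(1) P cr by (simp add: assoc_mult_mat[of _ "fst r" "fst r" _ "fst r" _ "fst r"])
      finally show ?thesis using Q cr by simp
    qed
    moreover have "invertible_mat Q"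
      using Q P by (auto intro: invertible_matI)
    ultimately show "(s, r) \<in> rep_iso G" using rs d Q unfolding rep_iso_def by auto
  qed
  show "trans (rep_iso G)"
  proof (rule transI)
    fix r s t assume "(r, s) \<in> rep_iso G" "(s, t) \<in> rep_iso G"
    then obtain P Q where rs: "irreducible_rep G r" "irreducible_rep G s" "irreducible_rep G t"
      and d: "fst r = fst s" "fst s = fst t"
      and P: "P \<in> carrier_mat (fst r) (fst r)" "invertible_mat P"
      and Q: "Q \<in> carrier_mat (fst r) (fst r)" "invertible_mat Q"
      and comm: "\<And>x. x \<in> carrier G \<Longrightarrow> P * snd r x = snd s x * P"
      and comm': "\<And>x. x \<in> carrier G \<Longrightarrow> Q * snd s x = snd t x * Q"
      unfolding rep_iso_def by auto
    have "(Q * P) * snd r x = snd t x * (Q * P)" if x: "x \<in> carrier G" for x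
    proof -
      note cr = rep_carrier[OF irreducible_repD(1)[OF rs(1)] x]
      note cs = rep_carrier[OF irreducible_repD(1)[OF rs(2)] x, folded d]
      note ct = rep_carrier[OF irreducible_repD(1)[OF rs(3)] x, folded d]
      have "(Q * P) * snd r x = Q * (snd s x * P)"
        using Q(1) P(1) cr comm[OF x] by (simp add: assoc_mult_mat[of _ "fst r" "fst r" _ "fst r" _ "fst r"])
      also have "\<dots> = (Q * snd s x) * P"
        using Q(1) P(1) cs d by (simp add: assoc_mult_mat[of _ "fst r" "fst r" _ "fst r" _ "fst r"])
      also have "\<dots> = snd t x * (Q * P)"
        using Q(1) P(1) ct d comm'[OF x] by (simp add: assoc_mult_mat[of _ "fst r" "fst r" _ "fst r" _ "fst r"])
      finally show ?thesis .
    qed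
    moreover have "invertible_mat (Q * P)"
    proof -
      obtain P' where P': "P' \<in> carrier_mat (fst r) (fst r)" "P * P' = 1\<^sub>m (fst r)" "P' * P = 1\<^sub>m (fst r)"
        using invertible_matE[OF P] .
      obtain Q' where Q': "Q' \<in> carrier_mat (fst r) (fst r)" "Q * Q' = 1\<^sub>m (fst r)" "Q' * Q = 1\<^sub>m (fst r)"
        using invertible_matE[OF Q] .
      have "(Q * P) * (P' * Q') = Q * (P * P') * Q'" "(P' * Q') * (Q * P) = P' * (Q' * Q) * P"
        using P(1) Q(1) P'(1) Q'(1) by (simp_all add: assoc_mult_mat[of _ "fst r" "fst r" _ "fst r" _ "fst r"])
      then show ?thesis
        using P(1) Q(1) P' Q' by (intro invertible_matI[of _ "fst r" "P' * Q'"]) auto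
    qed
    ultimately show "(r, t) \<in> rep_iso G" using rs d P Q unfolding rep_iso_def by auto
  qed
qed

text \<open>In the isomorphic case \<open>s\<close> may be replaced by \<open>r\<close>, and each of
  the d terms with i = j contributes |G| / d.\<close>

lemma character_orthogonality:
  assumes r: "irreducible_rep G r" and s: "irreducible_rep G s"
  shows "(\<Sum>x\<in>carrier G. rep_character r x * rep_character s (inv x)) =
    (if (r, s) \<in> rep_iso G then of_nat (card (carrier G)) else 0)"
proof -
  have E: "(\<Sum>x\<in>carrier G. rep_character p x * rep_character q (inv x)) =
     (\<Sum>i<fst p. \<Sum>j<fst q. \<Sum>x\<in>carrier G. snd p x $$ (i, i) * snd q (inv x) $$ (j, j))" for p q
    unfolding rep_character_def by (simp add: sum_product sum.swap[of _ "carrier G"])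
  show ?thesis
  proof (cases "(r, s) \<in> rep_iso G")
    case True
    then have "(\<Sum>x\<in>carrier G. rep_character r x * rep_character s (inv x)) =
      (\<Sum>x\<in>carrier G. rep_character r x * rep_character r (inv x))"
      using rep_character_iso by (intro sum.cong) auto
    also have "\<dots> = (\<Sum>i<fst r. \<Sum>j<fst r. if i = j then of_nat (card (carrier G)) / of_nat (fst r) else 0)"
      unfolding E using orthogonality_same[OF r] by (intro sum.cong) auto
    also have "\<dots> = of_nat (card (carrier G))" using irreducible_repD(2)[OF r] by simp
    finally show ?thesis using True by simp
  next
    case False
    then have "(s, r) \<notin> rep_iso G" using rep_iso_equiv unfolding equiv_def sym_def by blast
    then show ?thesis using False unfolding E by (simp add: orthogonality_not_iso[OF r s])
  qed
qed

section \<open>Splitting characters into irreducible ones\<close>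

lemma conjugate_representation:
  assumes r: "representation G r"
    and P: "P \<in> carrier_mat (fst r) (fst r)" and Q: "Q \<in> carrier_mat (fst r) (fst r)"
    and PQ: "P * Q = 1\<^sub>m (fst r)" and QP: "Q * P = 1\<^sub>m (fst r)"
  shows "representation G (fst r, \<lambda>x. Q * snd r x * P)"
    and "x \<in> carrier G \<Longrightarrow> rep_character (fst r, \<lambda>x. Q * snd r x * P) x = rep_character r x"
proof -
  note assoc = assoc_mult_mat[of _ "fst r" "fst r" _ "fst r" _ "fst r"]
  show "representation G (fst r, \<lambda>x. Q * snd r x * P)"
    unfolding representation_iff fst_conv snd_conv
  proof (intro conjI ballI)
    fix x y assume xy: "x \<in> carrier G" "y \<in> carrier G"
    note c = rep_carrier[OF r xy(1)] rep_carrier[OF r xy(2)]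
    have "Q * snd r x * P * (Q * snd r y * P) = Q * snd r x * (P * Q) * (snd r y * P)"
      using c P Q by (simp add: assoc)
    also have "\<dots> = Q * (snd r x * snd r y) * P" using c P Q by (simp add: PQ assoc)
    finally show "Q * snd r (x \<otimes> y) * P = Q * snd r x * P * (Q * snd r y * P)"
      using rep_mult[OF r xy] by simp
  qed (use rep_carrier[OF r] rep_one[OF r] P Q QP in auto)
  assume x: "x \<in> carrier G"
  note c = rep_carrier[OF r x]
  have "rep_character (fst r, \<lambda>x. Q * snd r x * P) x = (\<Sum>i<fst r. (Q * (snd r x * P)) $$ (i, i))"
    using P Q c by (simp add: rep_character_def assoc del: index_mult_mat)
  also have "\<dots> = (\<Sum>i<fst r. ((snd r x * P) * Q) $$ (i, i))"
    by (rule trace_mult_commute) (use P Q c in auto)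
  also have "(snd r x * P) * Q = snd r x * (P * Q)" by (rule assoc_mult_mat[OF c P Q])
  also have "(\<Sum>i<fst r. (snd r x * (P * Q)) $$ (i, i)) = rep_character r x"
    unfolding rep_character_def PQ using c by simp
  finally show "rep_character (fst r, \<lambda>x. Q * snd r x * P) x = rep_character r x" .
qed

text \<open>The hypothesis speaks of products so that it covers both diagonal blocks of a block
  triangular representation: in one case the second factor vanishes, in the other the first.\<close>

lemma block_representation:
  assumes r: "representation G r" and I: "I \<subseteq> {..<fst r}"
    and block: "\<And>x y i j l. x \<in> carrier G \<Longrightarrow> y \<in> carrier G \<Longrightarrow> i \<in> I \<Longrightarrow> j \<in> I \<Longrightarrow> l \<in> {..<fst r} - I \<Longrightarrow>
      snd r x $$ (i, l) * snd r y $$ (l, j) = 0"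
  obtains s where "representation G s" "fst s = card I"
    "\<And>x. x \<in> carrier G \<Longrightarrow> rep_character s x = (\<Sum>i\<in>I. snd r x $$ (i, i))"
proof -
  have "finite I" using I finite_subset by blast
  then obtain e where e: "bij_betw e {..<card I} I"
    using ex_bij_betw_nat_finite[of I] by (auto simp: atLeast0LessThan)
  have eI: "e i \<in> I" if "i < card I" for i using e that unfolding bij_betw_def by auto
  have er: "e i < fst r" if "i < card I" for i using eI[OF that] I by auto
  have inj: "e i = e j \<longleftrightarrow> i = j" if "i < card I" "j < card I" for i j
    using e that unfolding bij_betw_def inj_on_def by auto
  define s where "s = (card I, \<lambda>x. mat (card I) (card I) (\<lambda>(i, j). snd r x $$ (e i, e j)))"
  have "representation G s" unfolding representation_iff
  proof (intro conjI ballI)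
    fix x y assume xy: "x \<in> carrier G" "y \<in> carrier G"
    show "snd s (x \<otimes> y) = snd s x * snd s y"
    proof (rule eq_matI)
      fix i j assume "i < dim_row (snd s x * snd s y)" "j < dim_col (snd s x * snd s y)"
      then have ij: "i < card I" "j < card I" by (auto simp: s_def)
      have "snd s (x \<otimes> y) $$ (i, j) = (\<Sum>l<fst r. snd r x $$ (e i, l) * snd r y $$ (l, e j))"
        using rep_mult_entry[OF r xy er er] ij by (simp add: s_def)
      also have "\<dots> = (\<Sum>l\<in>I. snd r x $$ (e i, l) * snd r y $$ (l, e j))"
        using I block[OF xy eI eI] ij by (intro sum.mono_neutral_right) auto
      also have "\<dots> = (\<Sum>k<card I. snd r x $$ (e i, e k) * snd r y $$ (e k, e j))"
        by (rule sum.reindex_bij_betw[OF e, symmetric])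
      also have "\<dots> = (\<Sum>k<card I. snd s x $$ (i, k) * snd s y $$ (k, j))"
        using ij by (simp add: s_def)
      also have "\<dots> = (snd s x * snd s y) $$ (i, j)"
        using ij by (intro mat_mult_entry[symmetric]) (auto simp: s_def)
      finally show "snd s (x \<otimes> y) $$ (i, j) = (snd s x * snd s y) $$ (i, j)" .
    qed (auto simp: s_def)
  next
    show "snd s \<one> = 1\<^sub>m (fst s)"
      using rep_one[OF r] er inj by (intro eq_matI) (auto simp: s_def)
  qed (auto simp: s_def)
  moreover have "rep_character s x = (\<Sum>i\<in>I. snd r x $$ (i, i))" for x
    unfolding rep_character_def using sum.reindex_bij_betw[OF e, of "\<lambda>i. snd r x $$ (i, i)"]
    by (simp add: s_def)
  ultimately show ?thesis using that[of s] by (simp add: s_def)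
qed

text \<open>Complete reducibility is not needed: a block triangular form along an invariant subspace
  already splits the trace.\<close>

lemma character_decomposition:
  assumes "representation G r"
  shows "\<exists>rs. (\<forall>s\<in>set rs. irreducible_rep G s) \<and>
    (\<forall>x\<in>carrier G. rep_character r x = (\<Sum>s\<leftarrow>rs. rep_character s x))"
  using assms
proof (induction "fst r" arbitrary: r rule: less_induct)
  case less
  note r = less.prems
  consider "fst r = 0" | "irreducible_rep G r" | "fst r > 0" "\<not> irreducible_rep G r" by blast
  then show ?case
  proof cases
    \<comment> \<open>A representation of degree zero does not count as irreducible; the empty list
      of constituents accounts for it.\<close>
    case 1
    then show ?thesis by (intro exI[of _ "[]"]) (auto simp: rep_character_def)
  next
    case 2
    then show ?thesis by (intro exI[of _ "[r]"]) auto
  next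
    case 3
    then obtain W where W: "VectorSpace.subspace class_ring W (module_vec TYPE(complex) (fst r))"
      and inv: "\<And>x w. x \<in> carrier G \<Longrightarrow> w \<in> W \<Longrightarrow> snd r x *\<^sub>v w \<in> W"
      and proper: "W \<noteq> {0\<^sub>v (fst r)}" "W \<noteq> carrier_vec (fst r)"
      using r unfolding irreducible_rep_def by blast
    define n where "n = fst r"
    obtain I P Q where I: "I \<subseteq> {..<n}" and P: "P \<in> carrier_mat n n" and Q: "Q \<in> carrier_mat n n"
      and PQ: "P * Q = 1\<^sub>m n" and QP: "Q * P = 1\<^sub>m n"
      and W_iff: "\<And>v. v \<in> carrier_vec n \<Longrightarrow> v \<in> W \<longleftrightarrow> (\<forall>i\<in>{..<n} - I. (Q *\<^sub>v v) $ i = 0)"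
      using adapted_basis[OF W] unfolding n_def by metis
    have "W \<subseteq> carrier_vec n" "0\<^sub>v n \<in> W" using W unfolding subspace_vec_iff n_def by auto
    have "I \<noteq> {..<n}" using W_iff proper(2) \<open>W \<subseteq> carrier_vec n\<close> unfolding n_def by auto
    have "I \<noteq> {}"
    proof
      assume "I = {}"
      have "v = 0\<^sub>v n" if "v \<in> W" for v
      proof -
        have v: "v \<in> carrier_vec n" using that \<open>W \<subseteq> carrier_vec n\<close> by auto
        then have "Q *\<^sub>v v = 0\<^sub>v n" using W_iff that \<open>I = {}\<close> Q by (intro eq_vecI) auto
        moreover have "v = P *\<^sub>v (Q *\<^sub>v v)" using assoc_mult_mat_vec[OF P Q v] PQ v by simp
        ultimately show ?thesis using P by auto
      qed
      then show False using \<open>0\<^sub>v n \<in> W\<close> proper(1) unfolding n_def by blast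
    qed
    define t where "t = (n, \<lambda>x. Q * snd r x * P)"
    have t: "representation G t"
      and char_t: "\<And>x. x \<in> carrier G \<Longrightarrow> rep_character t x = rep_character r x"
      using conjugate_representation[OF r, of P Q] P Q PQ QP unfolding t_def n_def by auto
    have [simp]: "fst t = n" by (simp add: t_def)
    \<comment> \<open>The columns of \<open>P\<close> indexed by \<open>I\<close> lie in the
      invariant subspace \<open>W\<close>, and coordinates of vectors of \<open>W\<close> outside
      \<open>I\<close> vanish; so \<open>t\<close> is block triangular.\<close>
    have zero: "snd t x $$ (i, j) = 0" if x: "x \<in> carrier G" and ij: "i \<in> {..<n} - I" "j \<in> I" for x i j
    proof -
      have c: "snd r x \<in> carrier_mat n n" using rep_carrier[OF r x] unfolding n_def .
      have jn: "j < n" using ij I by auto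
      have colP: "col P j \<in> carrier_vec n" using P jn by auto
      have "Q *\<^sub>v col P j = unit_vec n j"
        using col_mult2[OF Q P jn] QP jn by simp
      then have "col P j \<in> W" using W_iff[OF colP] ij I by (auto simp: unit_vec_def)
      then have "snd r x *\<^sub>v col P j \<in> W" using inv x by auto
      then have "(Q *\<^sub>v (snd r x *\<^sub>v col P j)) $ i = 0"
        using W_iff[of "snd r x *\<^sub>v col P j"] c colP ij by auto
      also have "Q *\<^sub>v (snd r x *\<^sub>v col P j) = col (Q * snd r x * P) j"
        using assoc_mult_mat_vec[OF Q c colP] col_mult2[OF mult_carrier_mat[OF Q c] P jn] by simp
      finally show ?thesis using ij jn P Q by (simp add: t_def)
    qed
    obtain s1 where s1: "representation G s1" "fst s1 = card I"
      "\<And>x. x \<in> carrier G \<Longrightarrow> rep_character s1 x = (\<Sum>i\<in>I. snd t x $$ (i, i))"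
      by (rule block_representation[OF t, of I]) (use I zero in auto)
    obtain s2 where s2: "representation G s2" "fst s2 = card ({..<n} - I)"
      "\<And>x. x \<in> carrier G \<Longrightarrow> rep_character s2 x = (\<Sum>i\<in>{..<n} - I. snd t x $$ (i, i))"
      by (rule block_representation[OF t, of "{..<n} - I"]) (use I zero in auto)
    have "I \<subset> {..<n}" "{..<n} - I \<subset> {..<n}" using I \<open>I \<noteq> {}\<close> \<open>I \<noteq> {..<n}\<close> by auto
    then have "card I < n" "card ({..<n} - I) < n"
      by (metis card_lessThan finite_lessThan psubset_card_mono)+
    then obtain rs1 rs2 where
      "\<forall>s\<in>set rs1. irreducible_rep G s"
      "\<forall>x\<in>carrier G. rep_character s1 x = (\<Sum>s\<leftarrow>rs1. rep_character s x)"
      "\<forall>s\<in>set rs2. irreducible_rep G s"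
      "\<forall>x\<in>carrier G. rep_character s2 x = (\<Sum>s\<leftarrow>rs2. rep_character s x)"
      using less.hyps[OF _ s1(1)] less.hyps[OF _ s2(1)] s1(2) s2(2) unfolding n_def by metis
    moreover have "rep_character r x = rep_character s1 x + rep_character s2 x" if "x \<in> carrier G" for x
    proof -
      have "rep_character t x = (\<Sum>i<n. snd t x $$ (i, i))" by (simp add: rep_character_def)
      also have "\<dots> = (\<Sum>i\<in>{..<n} - I. snd t x $$ (i, i)) + (\<Sum>i\<in>I. snd t x $$ (i, i))"
        using I by (intro sum.subset_diff) auto
      finally show ?thesis using s1(3) s2(3) char_t that by simp
    qed
    ultimately show ?thesis by (intro exI[of _ "rs1 @ rs2"]) auto
  qed
qed

section \<open>The regular character and the finiteness of the set of irreducible classes\<close>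

text \<open>The matrices permute a basis indexed by the group, so the trace counts the fixed points
  of left multiplication by \<open>x\<close>: everything for the identity, nothing
  otherwise.\<close>

lemma regular_representation:
  obtains r where "representation G r"
    "\<And>x. x \<in> carrier G \<Longrightarrow> rep_character r x = (if x = \<one> then of_nat (card (carrier G)) else 0)"
proof -
  let ?n = "card (carrier G)"
  obtain e where e: "bij_betw e {..<?n} (carrier G)"
    using ex_bij_betw_nat_finite[OF finite_carrier] by (auto simp: atLeast0LessThan)
  have eG: "e i \<in> carrier G" if "i < ?n" for i using e that unfolding bij_betw_def by auto
  have inj: "e i = e j \<longleftrightarrow> i = j" if "i < ?n" "j < ?n" for i j
    using e that unfolding bij_betw_def inj_on_def by auto
  define r :: "'a rep" where
    "r = (?n, \<lambda>x. mat ?n ?n (\<lambda>(i, j). if e i = x \<otimes> e j then 1 else 0))"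
  have "representation G r" unfolding representation_iff
  proof (intro conjI ballI)
    fix x y assume xy: "x \<in> carrier G" "y \<in> carrier G"
    show "snd r (x \<otimes> y) = snd r x * snd r y"
    proof (rule eq_matI)
      fix i j assume "i < dim_row (snd r x * snd r y)" "j < dim_col (snd r x * snd r y)"
      then have ij: "i < ?n" "j < ?n" by (auto simp: r_def)
      have "y \<otimes> e j \<in> e ` {..<?n}" using e xy eG[OF ij(2)] unfolding bij_betw_def by auto
      then obtain k where k: "k < ?n" "e k = y \<otimes> e j" by auto
      have "(snd r x * snd r y) $$ (i, j) = (\<Sum>l<?n. snd r x $$ (i, l) * snd r y $$ (l, j))"
        using ij by (intro mat_mult_entry) (auto simp: r_def)
      also have "\<dots> = (\<Sum>l<?n. if l = k then snd r x $$ (i, k) else 0)"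
        using ij k inj by (intro sum.cong) (auto simp: r_def simp flip: k(2))
      also have "\<dots> = snd r x $$ (i, k)" using k by simp
      also have "\<dots> = snd r (x \<otimes> y) $$ (i, j)"
        using ij k xy eG by (simp add: r_def m_assoc)
      finally show "snd r (x \<otimes> y) $$ (i, j) = (snd r x * snd r y) $$ (i, j)" by simp
    qed (auto simp: r_def)
  next
    show "snd r \<one> = 1\<^sub>m (fst r)" using eG inj by (intro eq_matI) (auto simp: r_def)
  qed (auto simp: r_def)
  moreover have "rep_character r x = (if x = \<one> then of_nat ?n else 0)" if x: "x \<in> carrier G" for x
  proof -
    have "e i = x \<otimes> e i \<longleftrightarrow> x = \<one>" if "i < ?n" for i
      using r_cancel_one'[OF eG[OF that] x] .
    then show ?thesis by (simp add: rep_character_def r_def)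
  qed
  ultimately show ?thesis using that by blast
qed

text \<open>Literally the choice made inside \<open>irr_character\<close>, so matrix entries and
  characters refer to the same representative of a class.\<close>

abbreviation irr_rep :: "'a rep set \<Rightarrow> 'a rep" where
  "irr_rep j \<equiv> (SOME r. r \<in> j)"

lemma irr_rep_mem: "j \<in> irr_classes G \<Longrightarrow> irr_rep j \<in> j"
  unfolding irr_classes_def using in_quotient_imp_non_empty[OF rep_iso_equiv] by (metis some_in_eq)

lemma irr_class_irreducible: "j \<in> irr_classes G \<Longrightarrow> r \<in> j \<Longrightarrow> irreducible_rep G r"
  unfolding irr_classes_def using in_quotient_imp_subset[OF rep_iso_equiv] by blast

lemma irr_rep_irreducible: "j \<in> irr_classes G \<Longrightarrow> irreducible_rep G (irr_rep j)"
  using irr_rep_mem irr_class_irreducible by blast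

lemma irr_rep_iso_iff:
  assumes "j \<in> irr_classes G" "irreducible_rep G r"
  shows "(r, irr_rep j) \<in> rep_iso G \<longleftrightarrow> r \<in> j"
proof -
  obtain s where "j = rep_iso G `` {s}" using assms(1) unfolding irr_classes_def by (auto elim: quotientE)
  moreover have "irr_rep j \<in> j" using irr_rep_mem assms by blast
  ultimately show ?thesis
    using rep_iso_equiv unfolding equiv_def sym_def trans_def by (metis Image_singleton_iff)
qed

lemma irr_rep_iso_eq:
  assumes "i \<in> irr_classes G" "j \<in> irr_classes G" "(irr_rep i, irr_rep j) \<in> rep_iso G"
  shows "i = j"
proof -
  have "irr_rep i \<in> j" using assms irr_rep_iso_iff irr_rep_irreducible by blast
  then show ?thesis
    using quotient_disj[OF rep_iso_equiv, of i j] irr_rep_mem assms unfolding irr_classes_def by blast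
qed

lemma irr_character_one: "j \<in> irr_classes G \<Longrightarrow> irr_character j \<one> = of_nat (fst (irr_rep j))"
  unfolding irr_character_def rep_character_def
  using rep_one[OF irreducible_repD(1)[OF irr_rep_irreducible]] by simp

text \<open>Split the regular character into a list \<open>rs\<close> of irreducible ones. Pairing
  it with the character of \<open>j\<close> shows that \<open>j\<close> occurs exactly d_j times in
  \<open>rs\<close>. This multiplicity is positive, so the finite list meets every class; grouping
  it by classes gives the identity.\<close>

lemma
  shows finite_irr_classes: "finite (irr_classes G)"
    and regular_character: "x \<in> carrier G \<Longrightarrow>
      (\<Sum>j\<in>irr_classes G. of_nat (fst (irr_rep j)) * irr_character j x) =
      (if x = \<one> then of_nat (card (carrier G)) else 0)"
proof -
  obtain q where q: "representation G q"
    "\<And>x. x \<in> carrier G \<Longrightarrow> rep_character q x = (if x = \<one> then of_nat (card (carrier G)) else 0)"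
    using regular_representation by blast
  obtain rs where rs: "\<And>s. s \<in> set rs \<Longrightarrow> irreducible_rep G s"
    and dec: "\<And>x. x \<in> carrier G \<Longrightarrow> rep_character q x = (\<Sum>s\<leftarrow>rs. rep_character s x)"
    using character_decomposition[OF q(1)] by blast
  have card0: "card (carrier G) \<noteq> 0" using finite_carrier one_closed by auto
  have mult: "length (filter (\<lambda>r. r \<in> j) rs) = fst (irr_rep j)" if j: "j \<in> irr_classes G" for j
  proof -
    define s where "s = irr_rep j"
    have s: "irreducible_rep G s" using irr_rep_irreducible[OF j] unfolding s_def .
    \<comment> \<open>Only the identity contributes to a pairing with the regular character;
      \<open>inv \<one>\<close> is left as it is to match the summand at
      \<open>x = \<one>\<close>.\<close>
    have "of_nat (card (carrier G)) * of_nat (fst s) = of_nat (card (carrier G)) * rep_character s (inv \<one>)"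
      using rep_one[OF irreducible_repD(1)[OF s]] by (simp add: rep_character_def)
    also have "\<dots> = (\<Sum>x\<in>carrier G. if x = \<one> then of_nat (card (carrier G)) * rep_character s (inv \<one>) else 0)"
      using finite_carrier by simp
    also have "\<dots> = (\<Sum>x\<in>carrier G. rep_character q x * rep_character s (inv x))"
      using q(2) by (intro sum.cong) auto
    also have "\<dots> = (\<Sum>x\<in>carrier G. \<Sum>r\<leftarrow>rs. rep_character r x * rep_character s (inv x))"
      using dec by (simp add: sum_list_mult_const)
    also have "\<dots> = (\<Sum>r\<leftarrow>rs. \<Sum>x\<in>carrier G. rep_character r x * rep_character s (inv x))"
      by (induction rs) (auto simp: sum.distrib)
    also have "\<dots> = (\<Sum>r\<leftarrow>rs. if r \<in> j then of_nat (card (carrier G)) else 0)"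
      using character_orthogonality[OF rs s] irr_rep_iso_iff[OF j rs] unfolding s_def
      by (intro arg_cong[of _ _ sum_list] map_cong) auto
    also have "\<dots> = of_nat (card (carrier G)) * of_nat (length (filter (\<lambda>r. r \<in> j) rs))"
      by (induction rs) (auto simp: algebra_simps)
    finally show ?thesis using card0 unfolding s_def
      by (metis mult_cancel_left of_nat_eq_0_iff of_nat_eq_iff)
  qed
  have "irr_classes G \<subseteq> (\<lambda>r. rep_iso G `` {r}) ` set rs"
  proof
    fix j assume j: "j \<in> irr_classes G"
    have "filter (\<lambda>r. r \<in> j) rs \<noteq> []"
      using mult[OF j] irreducible_repD(2)[OF irr_rep_irreducible[OF j]] by auto
    then obtain r where r: "r \<in> set rs" "r \<in> j" by (auto simp: filter_empty_conv)
    have "j = rep_iso G `` {r}"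
      using j r rep_iso_equiv unfolding irr_classes_def
      by (metis Image_singleton_iff equiv_class_eq quotientE)
    then show "j \<in> (\<lambda>r. rep_iso G `` {r}) ` set rs" using r by blast
  qed
  then show fin: "finite (irr_classes G)" using finite_subset by blast
  assume x: "x \<in> carrier G"
  \<comment> \<open>An irreducible representation lies in exactly one class, so the sum selects a
    single term. This is what allows the grouping of \<open>rs\<close> by classes.\<close>
  have one: "(\<Sum>j\<in>irr_classes G. if r \<in> j then irr_character j x else 0) = rep_character r x"
    if r: "irreducible_rep G r" for r
  proof -
    have j: "rep_iso G `` {r} \<in> irr_classes G" "r \<in> rep_iso G `` {r}"
      using r equiv_class_self[OF rep_iso_equiv] unfolding irr_classes_def by (auto intro: quotientI)
    have "r \<in> i \<longleftrightarrow> i = rep_iso G `` {r}" if "i \<in> irr_classes G" for i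
      using that j quotient_disj[OF rep_iso_equiv, of i "rep_iso G `` {r}"]
      unfolding irr_classes_def by auto
    then have "(\<Sum>j\<in>irr_classes G. if r \<in> j then irr_character j x else 0) =
      (\<Sum>j\<in>irr_classes G. if j = rep_iso G `` {r} then irr_character (rep_iso G `` {r}) x else 0)"
      by (intro sum.cong refl) (metis (full_types))
    also have "\<dots> = irr_character (rep_iso G `` {r}) x" using j fin by simp
    also have "\<dots> = rep_character r x"
      unfolding irr_character_def using irr_rep_iso_iff[OF j(1) r] j(2) rep_character_iso x by metis
    finally show ?thesis .
  qed
  have "(\<Sum>j\<in>irr_classes G. of_nat (fst (irr_rep j)) * irr_character j x) =
    (\<Sum>j\<in>irr_classes G. of_nat (length (filter (\<lambda>r. r \<in> j) rs)) * irr_character j x)"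
    using mult by (intro sum.cong) auto
  also have "\<dots> = (\<Sum>j\<in>irr_classes G. \<Sum>r\<leftarrow>rs. if r \<in> j then irr_character j x else 0)"
    by (intro sum.cong refl, induction rs) (auto simp: algebra_simps)
  also have "\<dots> = (\<Sum>r\<leftarrow>rs. \<Sum>j\<in>irr_classes G. if r \<in> j then irr_character j x else 0)"
    by (induction rs) (auto simp: sum.distrib)
  also have "\<dots> = (\<Sum>r\<leftarrow>rs. rep_character r x)"
    using one rs by (intro arg_cong[of _ _ sum_list] map_cong) auto
  finally show "(\<Sum>j\<in>irr_classes G. of_nat (fst (irr_rep j)) * irr_character j x) =
      (if x = \<one> then of_nat (card (carrier G)) else 0)"
    using dec q(2) x by simp
qed

end

section \<open>Vertices of gluings\<close>

lemma sum_PiE_insert: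
  assumes "a \<notin> A"
  shows "(\<Sum>c\<in>Pi\<^sub>E (insert a A) X. f c) = (\<Sum>x\<in>X a. \<Sum>c\<in>Pi\<^sub>E A X. f (c(a := x)))"
proof -
  have "(\<Sum>c\<in>Pi\<^sub>E (insert a A) X. f c) = (\<Sum>(x, c)\<in>X a \<times> Pi\<^sub>E A X. f (c(a := x)))"
    using sum.reindex[OF inj_combinator[OF assms, of X], of f]
    by (simp add: PiE_insert_eq case_prod_unfold comp_def)
  then show ?thesis by (simp add: sum.cartesian_product)
qed

text \<open>A function on a disjoint union is a family of functions on the blocks, and the last
  hypothesis says that \<open>f k\<close> sees only its own block. Used twice: with triangles as
  blocks of corners, and with glued pairs and boundary sides as blocks of colored sides.\<close>

lemma sum_PiE_partition:
  fixes f :: "'k \<Rightarrow> ('s \<Rightarrow> 'x) \<Rightarrow> 'c :: comm_semiring_1"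
  assumes "finite K" "\<And>k l. k \<in> K \<Longrightarrow> l \<in> K \<Longrightarrow> k \<noteq> l \<Longrightarrow> S k \<inter> S l = {}"
    and "\<And>k c c'. k \<in> K \<Longrightarrow> (\<And>s. s \<in> S k \<Longrightarrow> c s = c' s) \<Longrightarrow> f k c = f k c'"
  shows "(\<Sum>c\<in>Pi\<^sub>E (\<Union>k\<in>K. S k) X. \<Prod>k\<in>K. f k c) = (\<Prod>k\<in>K. \<Sum>c\<in>Pi\<^sub>E (S k) X. f k c)"
  using assms
proof (induction K rule: finite_induct)
  case empty
  then show ?case by simp
next
  case (insert k K)
  let ?U = "\<Union>k\<in>K. S k"
  have dj: "S k \<inter> ?U = {}" using insert.prems(1)[of k] insert.hyps by fastforce
  then have dj': "x \<notin> S l" if "x \<in> S k" "l \<in> K" for x l using that by blast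
  have split: "(\<Prod>l\<in>insert k K. f l (\<lambda>s. if s \<in> S k then c s else c' s)) = f k c * (\<Prod>l\<in>K. f l c')" for c c'
  proof -
    have "f k (\<lambda>s. if s \<in> S k then c s else c' s) = f k c" by (rule insert.prems(2)) auto
    moreover have "f l (\<lambda>s. if s \<in> S k then c s else c' s) = f l c'" if "l \<in> K" for l
      using that dj by (intro insert.prems(2)) auto
    ultimately show ?thesis using insert.hyps by simp
  qed
  have "(\<Sum>c\<in>Pi\<^sub>E (\<Union>k\<in>insert k K. S k) X. \<Prod>l\<in>insert k K. f l c) =
      (\<Sum>(c, c')\<in>Pi\<^sub>E (S k) X \<times> Pi\<^sub>E ?U X. f k c * (\<Prod>l\<in>K. f l c'))"
  proof (rule sum.reindex_bij_witness[of _ "\<lambda>(c, c') s. if s \<in> S k then c s else c' s"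
          "\<lambda>c. (restrict c (S k), restrict c ?U)"], goal_cases)
    case (1 c)
    then show ?case by (auto simp: fun_eq_iff PiE_iff extensional_def)
  next
    case (2 c)
    then show ?case by (auto simp: PiE_iff)
  next
    case (3 c)
    then show ?case using dj' by (auto simp: fun_eq_iff PiE_iff extensional_def)
  next
    case (4 c)
    then show ?case by (auto simp: PiE_iff extensional_def)
  next
    case (5 c)
    have "(\<lambda>s. if s \<in> S k then restrict c (S k) s else restrict c ?U s) = c"
      using 5 by (auto simp: fun_eq_iff PiE_iff extensional_def)
    then show ?case using split[of "restrict c (S k)" "restrict c ?U"] by simp
  qed
  also have "\<dots> = (\<Sum>c\<in>Pi\<^sub>E (S k) X. f k c) * (\<Sum>c'\<in>Pi\<^sub>E ?U X. \<Prod>l\<in>K. f l c')"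
    by (simp add: sum_product sum.cartesian_product)
  also have "(\<Sum>c'\<in>Pi\<^sub>E ?U X. \<Prod>l\<in>K. f l c') = (\<Prod>l\<in>K. \<Sum>c\<in>Pi\<^sub>E (S l) X. f l c)"
  proof (rule insert.IH)
    show "S l \<inter> S m = {}" if "l \<in> K" "m \<in> K" "l \<noteq> m" for l m
      using insert.prems(1)[of l m] that by simp
    show "f l c = f l c'" if "l \<in> K" "\<And>s. s \<in> S l \<Longrightarrow> c s = c' s" for l c c'
      using that by (intro insert.prems(2)) simp_all
  qed
  finally show ?case using insert.hyps by simp
qed

text \<open>A deterministic relation is confluent, so a zigzag can be straightened into two forward
  walks that meet.\<close>

lemma connected_functional_joinable:
  assumes "(s, t) \<in> (R \<union> R\<inverse>)\<^sup>*" "single_valued R"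
  shows "\<exists>u. (s, u) \<in> R\<^sup>* \<and> (t, u) \<in> R\<^sup>*"
  using assms(1)
proof (induction rule: rtrancl_induct)
  case base
  then show ?case by blast
next
  case (step t t')
  then obtain u where u: "(s, u) \<in> R\<^sup>*" "(t, u) \<in> R\<^sup>*" by blast
  show ?case
  proof (cases "(t, t') \<in> R")
    case True
    from u(2) show ?thesis
    proof (cases rule: converse_rtranclE)
      case base
      then show ?thesis using u True by (meson rtrancl.simps)
    next
      case (step x)
      then have "x = t'" using True assms(2) by (auto dest: single_valuedD)
      then show ?thesis using step u by blast
    qed
  next
    case False
    then show ?thesis using step u by (meson UnE converseD converse_rtrancl_into_rtrancl)
  qed
qed

section \<open>Gluings and their corner relation\<close>

lemma
  assumes "gluing K"
  shows gluing_finite_tris: "finite (gl_tris K)"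
    and gluing_finite_sides: "finite (gl_sides K)"
    and gluing_finite_pairs: "finite (gl_pairs K)"
proof -
  show "finite (gl_tris K)" using assms unfolding gluing_def by auto
  then show "finite (gl_sides K)" unfolding gl_sides_def by auto
  then show "finite (gl_pairs K)"
    using assms finite_subset[of "gl_pairs K" "gl_sides K \<times> gl_sides K"] unfolding gluing_def by auto
qed

lemma
  assumes "gluing K" "(a, b) \<in> gl_pairs K"
  shows gluing_pair_sides: "a \<in> gl_sides K" "b \<in> gl_sides K"
    and gluing_pair_neq: "a \<noteq> b"
    and gluing_pair_not_bdry: "a \<notin> set (gl_bdry K)" "b \<notin> set (gl_bdry K)"
  using assms unfolding gluing_def by fast+

lemma gluing_pair_eq:
  assumes "gluing K" "(a, b) \<in> gl_pairs K" "(a', b') \<in> gl_pairs K" "{a, b} \<inter> {a', b'} \<noteq> {}"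
  shows "a = a' \<and> b = b'"
proof -
  have "\<forall>p \<in> gl_pairs K. \<forall>q \<in> gl_pairs K. {fst p, snd p} \<inter> {fst q, snd q} \<noteq> {} \<longrightarrow> p = q"
    using assms(1) unfolding gluing_def case_prod_unfold by simp
  from this[rule_format, of "(a, b)" "(a', b')"] show ?thesis using assms(2-4) by simp
qed

lemma gluing_sides_split:
  assumes "gluing K"
  shows "gl_sides K = (\<Union>(a, b)\<in>gl_pairs K. {a, b}) \<union> set (gl_bdry K)"
proof -
  have "set (gl_bdry K) = gl_sides K - (Domain (gl_pairs K) \<union> Range (gl_pairs K))"
    using assms unfolding gluing_def by blast
  then show ?thesis using gluing_pair_sides[OF assms] by (auto split: prod.splits)
qed

lemma next_side_mem: "s \<in> gl_sides K \<Longrightarrow> next_side s \<in> gl_sides K"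
  unfolding gl_sides_def next_side_def by auto

lemma gl_corner_rel_refl: "(s, s) \<in> gl_corner_rel K"
  unfolding gl_corner_rel_def Let_def by simp

lemma gl_corner_rel_sym: "(s, t) \<in> gl_corner_rel K \<Longrightarrow> (t, s) \<in> gl_corner_rel K"
  unfolding gl_corner_rel_def Let_def using sym_rtrancl[OF sym_Un_converse] by (meson symD)

lemma gl_corner_rel_trans:
  "(s, t) \<in> gl_corner_rel K \<Longrightarrow> (t, u) \<in> gl_corner_rel K \<Longrightarrow> (s, u) \<in> gl_corner_rel K"
  unfolding gl_corner_rel_def Let_def by simp

lemma gl_corner_rel_pair:
  assumes "(a, b) \<in> gl_pairs K"
  shows "(a, next_side b) \<in> gl_corner_rel K" "(next_side a, b) \<in> gl_corner_rel K"
  unfolding gl_corner_rel_def Let_def using assms by (auto intro!: r_into_rtrancl)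

text \<open>With equality of two function values as \<open>P\<close>, this shows that a labeling of
  corners is constant on vertices.\<close>

lemma gl_corner_rel_induct:
  assumes "(s, t) \<in> gl_corner_rel K"
    and "\<And>s. P s s" "\<And>s t. P s t \<Longrightarrow> P t s" "\<And>s t u. P s t \<Longrightarrow> P t u \<Longrightarrow> P s u"
    and "\<And>a b. (a, b) \<in> gl_pairs K \<Longrightarrow> P a (next_side b) \<and> P (next_side a) b"
  shows "P s t"
  using assms(1) unfolding gl_corner_rel_def Let_def
proof (induction rule: rtrancl_induct)
  case base
  show ?case by (rule assms(2))
next
  case (step t u)
  then have "P t u" using assms(3,5) by blast
  with step.IH show ?case by (rule assms(4))
qed

lemma gl_corner_class_eq_iff:
  "gl_corner_rel K `` {s} = gl_corner_rel K `` {t} \<longleftrightarrow> (s, t) \<in> gl_corner_rel K"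
  using gl_corner_rel_refl gl_corner_rel_sym gl_corner_rel_trans by fast

text \<open>The corners around a vertex are traversed by crossing one identified side after the other.
  Such a walk is deterministic and gets stuck exactly at an unpaired side, so a vertex lies on at
  most one unpaired side.\<close>

lemma boundary_vertices_distinct:
  assumes K: "gluing K" and st: "s \<in> set (gl_bdry K)" "t \<in> set (gl_bdry K)"
    and rel: "(s, t) \<in> gl_corner_rel K"
  shows "s = t"
proof -
  \<comment> \<open>Compared with the generators of \<open>gl_corner_rel\<close> the second pair is
    reversed. The symmetric closure stays the same, but \<open>R\<close> is deterministic: a corner
    can move only across the side that starts there.\<close>
  define R where "R = (\<Union>(a, b)\<in>gl_pairs K. {(a, next_side b), (b, next_side a)})"
  have "gl_corner_rel K = (R \<union> R\<inverse>)\<^sup>*"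
    unfolding gl_corner_rel_def Let_def R_def by (rule arg_cong[of _ _ rtrancl]) auto
  moreover have "single_valued R"
  proof (rule single_valuedI)
    fix x y z assume "(x, y) \<in> R" "(x, z) \<in> R"
    then obtain p q where p: "(x, p) \<in> gl_pairs K \<or> (p, x) \<in> gl_pairs K" "y = next_side p"
      and q: "(x, q) \<in> gl_pairs K \<or> (q, x) \<in> gl_pairs K" "z = next_side q"
      unfolding R_def by auto
    have "p = q" using p(1) q(1)
      using gluing_pair_eq[OF K, of x p x q] gluing_pair_eq[OF K, of x p q x]
        gluing_pair_eq[OF K, of p x x q] gluing_pair_eq[OF K, of p x q x]
        gluing_pair_neq[OF K, of x p] gluing_pair_neq[OF K, of p x]
      by auto
    then show "y = z" using p q by simp
  qed
  ultimately obtain u where u: "(s, u) \<in> R\<^sup>*" "(t, u) \<in> R\<^sup>*"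
    using connected_functional_joinable[of s t R] rel by auto
  \<comment> \<open>No step leaves an unpaired side, so both walks to the common end
    \<open>u\<close> have length zero.\<close>
  have stuck: "(x, y) \<notin> R" if "x \<in> set (gl_bdry K)" for x y
    using that gluing_pair_not_bdry[OF K] unfolding R_def by auto
  have "s = u" "t = u" using u st stuck by (meson converse_rtranclE)+
  then show ?thesis by simp
qed

text \<open>A labeling that satisfies the gluing conditions is a labeling of vertices. By the loop
  hypothesis both indices of \<open>F s\<close> sit at one vertex, and different boundary sides have
  different vertices; so the sum splits into one trace per boundary side and a factor
  \<open>d\<close> for each remaining vertex.\<close>

lemma
  fixes F :: "side \<Rightarrow> nat \<Rightarrow> nat \<Rightarrow> complex"
  assumes K: "gluing K" and loops: "\<And>s. s \<in> set (gl_bdry K) \<Longrightarrow> (s, next_side s) \<in> gl_corner_rel K"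
  shows card_bdry_le_card_vertices: "length (gl_bdry K) \<le> card (gl_vertices K)"
    and sum_corner_labels: "(\<Sum>a\<in>gl_sides K \<rightarrow>\<^sub>E {..<d}.
        if \<forall>(p, q)\<in>gl_pairs K. a p = a (next_side q) \<and> a (next_side p) = a q
        then \<Prod>s\<in>set (gl_bdry K). F s (a s) (a (next_side s)) else 0) =
      of_nat d ^ (card (gl_vertices K) - length (gl_bdry K)) *
      (\<Prod>s\<in>set (gl_bdry K). \<Sum>k<d. F s k k)"
proof -
  let ?S = "gl_sides K" and ?P = "gl_pairs K" and ?B = "set (gl_bdry K)" and ?V = "gl_vertices K"
  define cls where "cls = (\<lambda>s. gl_corner_rel K `` {s})"
  have finS: "finite ?S" using gluing_finite_sides[OF K] .
  have B: "?B \<subseteq> ?S" using gluing_sides_split[OF K] by auto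
  have V: "?V = cls ` ?S" unfolding gl_vertices_def quotient_def cls_def by auto
  have finV: "finite ?V" using finS V by simp
  have cls_eq: "cls s = cls t \<longleftrightarrow> (s, t) \<in> gl_corner_rel K" for s t
    unfolding cls_def by (rule gl_corner_class_eq_iff)
  have inj: "inj_on cls ?B" using boundary_vertices_distinct[OF K] cls_eq by (auto intro!: inj_onI)
  have card: "card (cls ` ?B) = length (gl_bdry K)"
  proof -
    have "distinct (gl_bdry K)" using K unfolding gluing_def by blast
    then show ?thesis using inj by (simp add: card_image distinct_card)
  qed
  have sub: "cls ` ?B \<subseteq> ?V" using B V by auto
  show "length (gl_bdry K) \<le> card ?V" using card_mono[OF finV sub] card by simp

  define compat where
    "compat = (\<lambda>a :: side \<Rightarrow> nat. \<forall>(p, q)\<in>?P. a p = a (next_side q) \<and> a (next_side p) = a q)"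
  have const: "a s = a t" if "compat a" "cls s = cls t" for a s t
    using that(2)[unfolded cls_eq]
    by (rule gl_corner_rel_induct) (use that(1) in \<open>auto simp: compat_def\<close>)
  \<comment> \<open>\<open>rp\<close> selects a corner at each vertex; reading a compatible labeling
    off there inverts the pullback along \<open>cls\<close>.\<close>
  define rp where "rp = (\<lambda>v. SOME s. s \<in> ?S \<and> cls s = v)"
  have rp: "rp v \<in> ?S \<and> cls (rp v) = v" if "v \<in> ?V" for v
    unfolding rp_def by (rule someI_ex) (use that V in auto)
  have "(\<Sum>a\<in>?S \<rightarrow>\<^sub>E {..<d}. if compat a then \<Prod>s\<in>?B. F s (a s) (a (next_side s)) else 0) =
      (\<Sum>a\<in>{a \<in> ?S \<rightarrow>\<^sub>E {..<d}. compat a}. \<Prod>s\<in>?B. F s (a s) (a (next_side s)))"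
    using finS by (intro sum.inter_filter[symmetric]) (auto intro: finite_PiE)
  also have "\<dots> = (\<Sum>b\<in>?V \<rightarrow>\<^sub>E {..<d}. \<Prod>s\<in>?B. F s (b (cls s)) (b (cls s)))"
  proof (rule sum.reindex_bij_witness[of _ "\<lambda>b. \<lambda>s\<in>?S. b (cls s)" "\<lambda>a. \<lambda>v\<in>?V. a (rp v)"], goal_cases)
    case (1 a)
    then have "a (rp (cls s)) = a s" if "s \<in> ?S" for s
      using const[of a] rp[of "cls s"] that V by blast
    then show ?case using 1 V by (auto simp: fun_eq_iff PiE_iff extensional_def)
  next
    case (2 a)
    then show ?case using rp by (auto simp: PiE_iff)
  next
    case (3 b)
    then show ?case using rp by (auto simp: fun_eq_iff PiE_iff extensional_def)
  next
    case (4 b)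
    have "compat (\<lambda>s\<in>?S. b (cls s))"
      unfolding compat_def
    proof (clarify)
      fix p q assume pq: "(p, q) \<in> ?P"
      have "cls p = cls (next_side q)" "cls (next_side p) = cls q"
        using gl_corner_rel_pair[OF pq] cls_eq by auto
      then show "(\<lambda>s\<in>?S. b (cls s)) p = (\<lambda>s\<in>?S. b (cls s)) (next_side q) \<and>
          (\<lambda>s\<in>?S. b (cls s)) (next_side p) = (\<lambda>s\<in>?S. b (cls s)) q"
        using gluing_pair_sides[OF K pq] next_side_mem by auto
    qed
    then show ?case using 4 V by (auto simp: PiE_iff)
  next
    case (5 a)
    show ?case
    proof (intro prod.cong refl)
      fix s assume s: "s \<in> ?B"
      then have sS: "s \<in> ?S" using B by auto
      have "a (rp (cls s)) = a s"
        using 5 const[of a] rp[of "cls s"] sS V by blast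
      moreover have "a (next_side s) = a s"
        using 5 const[of a s "next_side s"] cls_eq loops[OF s] by simp
      ultimately show "F s ((\<lambda>v\<in>?V. a (rp v)) (cls s)) ((\<lambda>v\<in>?V. a (rp v)) (cls s)) = F s (a s) (a (next_side s))"
        using sS V by simp
    qed
  qed
  \<comment> \<open>Moving the product from boundary sides to their vertices, with 1 at all others,
    brings it into the form to which distributivity applies.\<close>
  also have "\<dots> = (\<Sum>b\<in>?V \<rightarrow>\<^sub>E {..<d}. \<Prod>v\<in>?V. if v \<in> cls ` ?B then F (inv_into ?B cls v) (b v) (b v) else 1)"
  proof (intro sum.cong refl)
    fix b
    have "(\<Prod>s\<in>?B. F s (b (cls s)) (b (cls s))) =
        (\<Prod>v\<in>cls ` ?B. F (inv_into ?B cls v) (b v) (b v))"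
      using inj by (simp add: prod.reindex)
    also have "\<dots> = (\<Prod>v\<in>?V. if v \<in> cls ` ?B then F (inv_into ?B cls v) (b v) (b v) else 1)"
      using sub finV by (intro prod.mono_neutral_cong_left) auto
    finally show "(\<Prod>s\<in>?B. F s (b (cls s)) (b (cls s))) = \<dots>" .
  qed
  also have "\<dots> = (\<Prod>v\<in>?V. \<Sum>k<d. if v \<in> cls ` ?B then F (inv_into ?B cls v) k k else 1)"
    using finV by (intro prod_sum_PiE[symmetric]) auto
  also have "\<dots> = (\<Prod>v\<in>?V - cls ` ?B. of_nat d) * (\<Prod>v\<in>cls ` ?B. \<Sum>k<d. F (inv_into ?B cls v) k k)"
    using sub finV by (subst prod.subset_diff[of "cls ` ?B"]) auto
  also have "\<dots> = of_nat d ^ (card ?V - length (gl_bdry K)) * (\<Prod>s\<in>?B. \<Sum>k<d. F s k k)"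
    using inj sub finV card by (simp add: prod.reindex card_Diff_subset finite_subset)
  finally show "(\<Sum>a\<in>?S \<rightarrow>\<^sub>E {..<d}.
        if \<forall>(p, q)\<in>?P. a p = a (next_side q) \<and> a (next_side p) = a q
        then \<Prod>s\<in>?B. F s (a s) (a (next_side s)) else 0) =
      of_nat d ^ (card ?V - length (gl_bdry K)) * (\<Prod>s\<in>?B. \<Sum>k<d. F s k k)"
    unfolding compat_def .
qed

section \<open>Existence of triangulations\<close>

text \<open>Used to obtain the number of pairs of the standard gluing without enumerating
  them.\<close>

lemma card_gl_sides:
  assumes "gluing K"
  shows "card (gl_sides K) = 2 * card (gl_pairs K) + length (gl_bdry K)"
proof -
  let ?U = "\<Union>p\<in>gl_pairs K. {fst p, snd p}"
  note fin = gluing_finite_pairs[OF assms]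
  have "gl_sides K = ?U \<union> set (gl_bdry K)"
    using gluing_sides_split[OF assms] by (simp add: case_prod_unfold)
  moreover have "?U \<inter> set (gl_bdry K) = {}"
    using gluing_pair_not_bdry[OF assms] by fastforce
  moreover have "card ?U = (\<Sum>p\<in>gl_pairs K. card {fst p, snd p})"
  proof (rule card_UN_disjoint)
    show "\<forall>p\<in>gl_pairs K. \<forall>q\<in>gl_pairs K. p \<noteq> q \<longrightarrow> {fst p, snd p} \<inter> {fst q, snd q} = {}"
      using gluing_pair_eq[OF assms] by (metis prod.collapse prod_eq_iff)
  qed (use fin in auto)
  moreover have "\<dots> = (\<Sum>p\<in>gl_pairs K. 2)"
    using gluing_pair_neq[OF assms] by (intro sum.cong) auto
  moreover have "card (set (gl_bdry K)) = length (gl_bdry K)"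
    using assms unfolding gluing_def by (metis distinct_card)
  ultimately show ?thesis
    using fin by (simp add: card_Un_disjoint)
qed

lemma card_image_eq_if_same_fibres:
  assumes "\<And>s t. s \<in> S \<Longrightarrow> t \<in> S \<Longrightarrow> f s = f t \<longleftrightarrow> g s = g t"
  shows "card (f ` S) = card (g ` S)"
proof (rule bij_betw_same_card)
  have "f (inv_into S f (f s)) = f s" "inv_into S f (f s) \<in> S" if "s \<in> S" for s
    using that by (auto intro: f_inv_into_f inv_into_into)
  then have *: "g (inv_into S f (f s)) = g s" if "s \<in> S" for s using assms that by blast
  show "bij_betw (\<lambda>v. g (inv_into S f v)) (f ` S) (g ` S)"
    unfolding bij_betw_def
  proof
    show "inj_on (\<lambda>v. g (inv_into S f v)) (f ` S)" using * assms by (auto intro!: inj_onI)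
    show "(\<lambda>v. g (inv_into S f v)) ` f ` S = g ` S" using * by (auto simp: image_image)
  qed
qed

text \<open>The standard triangulation cones off the boundary of a polygon whose sides spell the word
  \<open>\<Prod>\<^sub>i c\<^sub>i x\<^sub>i c\<^sub>i\<inverse> \<cdot> \<Prod>\<^sub>j [a\<^sub>j, b\<^sub>j] \<cdot> t t\<inverse>\<close>, the \<open>x\<^sub>i\<close> being left unpaired. The final \<open>t t\<inverse>\<close> keeps the
  polygon nonempty when \<open>g = n = 0\<close>. Side 0 of triangle \<open>k\<close> is the k-th side of the polygon, and corner
  2 is the apex.\<close>

definition polygon_size :: "nat \<Rightarrow> nat \<Rightarrow> nat" where
  "polygon_size g n = 3 * n + 4 * g + 2"

definition polygon_next :: "nat \<Rightarrow> nat \<Rightarrow> nat \<Rightarrow> nat" where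
  "polygon_next g n t = (if Suc t = polygon_size g n then 0 else Suc t)"

text \<open>Positions 3i, 3i + 1, 3i + 2 hold c_i, x_i and the inverse of c_i. The four positions
  from 3n + 4j on spell a commutator, so its first and third, second and fourth letters are paired.
  The last two positions hold t and its inverse.\<close>

definition polygon_pairs :: "nat \<Rightarrow> nat \<Rightarrow> (nat \<times> nat) set" where
  "polygon_pairs g n = {(3 * i, 3 * i + 2) | i. i < n} \<union>
     {(3 * n + 4 * j, 3 * n + 4 * j + 2) | j. j < g} \<union>
     {(3 * n + 4 * j + 1, 3 * n + 4 * j + 3) | j. j < g} \<union>
     {(3 * n + 4 * g, 3 * n + 4 * g + 1)}"

text \<open>Side 1 of triangle \<open>t\<close> runs from the end of polygon side \<open>t\<close>
  to the apex, and side 2 returns from the apex to its start. So side 1 is glued to side 2 of the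
  next triangle.\<close>

definition standard_gluing :: "nat \<Rightarrow> nat \<Rightarrow> gluing" where
  "standard_gluing g n = \<lparr>gl_tris = {..<polygon_size g n},
     gl_pairs = {((t, 1), (polygon_next g n t, 2)) | t. t < polygon_size g n} \<union>
       {((p, 0), (q, 0)) | p q. (p, q) \<in> polygon_pairs g n},
     gl_bdry = map (\<lambda>i. (3 * i + 1, 0)) [0..<n]\<rparr>"

lemma polygon_next_less: "t < polygon_size g n \<Longrightarrow> polygon_next g n t < polygon_size g n"
  unfolding polygon_next_def by (simp add: polygon_size_def)

lemma polygon_next_inj: "polygon_next g n t = polygon_next g n u \<Longrightarrow> t = u"
  unfolding polygon_next_def by (auto split: if_splits)

lemma polygon_next_surj: "t < polygon_size g n \<Longrightarrow> \<exists>u<polygon_size g n. t = polygon_next g n u"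
proof (cases t)
  case 0
  then show ?thesis
    by (intro exI[of _ "3 * n + 4 * g + 1"]) (simp add: polygon_next_def polygon_size_def)
next
  case (Suc u)
  moreover assume "t < polygon_size g n"
  ultimately show ?thesis by (intro exI[of _ u]) (simp add: polygon_next_def)
qed

lemma polygon_pairs_bounds:
  "(p, q) \<in> polygon_pairs g n \<Longrightarrow> p < q \<and> q < polygon_size g n"
  unfolding polygon_pairs_def polygon_size_def by auto

lemma polygon_pairs_eq:
  assumes "(p, q) \<in> polygon_pairs g n" "(p', q') \<in> polygon_pairs g n"
    and "p = p' \<or> p = q' \<or> q = p' \<or> q = q'"
  shows "p = p' \<and> q = q'"
  using assms unfolding polygon_pairs_def
  by (elim UnE disjE; clarsimp; (linarith | presburger))

text \<open>Ensures that \<open>gl_bdry\<close> lists precisely the unpaired sides. Positions in the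
  boundary blocks are told apart modulo 3, those in the handles modulo 4.\<close>

lemma polygon_sides_cases:
  assumes "t < polygon_size g n"
  shows "(\<exists>i<n. t = 3 * i + 1) \<or> (\<exists>q. (t, q) \<in> polygon_pairs g n) \<or> (\<exists>p. (p, t) \<in> polygon_pairs g n)"
    and "\<not> ((\<exists>i<n. t = 3 * i + 1) \<and> ((\<exists>q. (t, q) \<in> polygon_pairs g n) \<or> (\<exists>p. (p, t) \<in> polygon_pairs g n)))"
proof -
  consider "t < 3 * n" | "3 * n \<le> t" "t < 3 * n + 4 * g" | "t = 3 * n + 4 * g" | "t = 3 * n + 4 * g + 1"
    using assms unfolding polygon_size_def by linarith
  then show "(\<exists>i<n. t = 3 * i + 1) \<or> (\<exists>q. (t, q) \<in> polygon_pairs g n) \<or> (\<exists>p. (p, t) \<in> polygon_pairs g n)"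
  proof cases
    case 1
    define i where "i = t div 3"
    have i: "i < n" and t: "t = 3 * i \<or> t = 3 * i + 1 \<or> t = 3 * i + 2"
      using 1 unfolding i_def by presburger+
    have Q: "(3 * i, 3 * i + 2) \<in> polygon_pairs g n" using i unfolding polygon_pairs_def by blast
    from t show ?thesis
    proof (elim disjE)
      assume "t = 3 * i"
      then show ?thesis using Q by metis
    next
      assume "t = 3 * i + 1"
      then show ?thesis using i by metis
    next
      assume "t = 3 * i + 2"
      then show ?thesis using Q by metis
    qed
  next
    case 2
    then obtain s where s: "t = 3 * n + s" "s < 4 * g" using le_Suc_ex by fastforce
    define j where "j = s div 4"
    have j: "j < g" using s(2) unfolding j_def by (simp add: less_mult_imp_div_less mult.commute)
    have "s = 4 * j \<or> s = 4 * j + 1 \<or> s = 4 * j + 2 \<or> s = 4 * j + 3"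
      unfolding j_def by presburger
    then have t: "t = 3 * n + 4 * j \<or> t = 3 * n + 4 * j + 1 \<or>
        t = 3 * n + 4 * j + 2 \<or> t = 3 * n + 4 * j + 3"
      using s(1) by auto
    have Q: "(3 * n + 4 * j, 3 * n + 4 * j + 2) \<in> polygon_pairs g n"
      "(3 * n + 4 * j + 1, 3 * n + 4 * j + 3) \<in> polygon_pairs g n"
      using j unfolding polygon_pairs_def by blast+
    from t have "(\<exists>q. (t, q) \<in> polygon_pairs g n) \<or> (\<exists>p. (p, t) \<in> polygon_pairs g n)"
      by (elim disjE) (metis Q)+
    then show ?thesis by blast
  next
    case 3
    then show ?thesis unfolding polygon_pairs_def by blast
  next
    case 4
    then show ?thesis unfolding polygon_pairs_def by blast
  qed
  show "\<not> ((\<exists>i<n. t = 3 * i + 1) \<and> ((\<exists>q. (t, q) \<in> polygon_pairs g n) \<or> (\<exists>p. (p, t) \<in> polygon_pairs g n)))"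
  proof
    assume "(\<exists>i<n. t = 3 * i + 1) \<and> ((\<exists>q. (t, q) \<in> polygon_pairs g n) \<or> (\<exists>p. (p, t) \<in> polygon_pairs g n))"
    then obtain i q where i: "i < n" "t = 3 * i + 1"
      and "(t, q) \<in> polygon_pairs g n \<or> (q, t) \<in> polygon_pairs g n" by blast
    then show False unfolding polygon_pairs_def i(2)
      by (elim disjE UnE; clarsimp; (linarith | presburger))
  qed
qed

lemma gluing_standard_gluing: "gluing (standard_gluing g n)"
proof -
  let ?K = "standard_gluing g n" and ?m = "polygon_size g n" and ?Q = "polygon_pairs g n"
  have tris: "gl_tris ?K = {..<?m}" and bdry: "gl_bdry ?K = map (\<lambda>i. (3 * i + 1, 0)) [0..<n]"
    and pairs: "\<And>a b. (a, b) \<in> gl_pairs ?K \<longleftrightarrow> (\<exists>t<?m. a = (t, 1) \<and> b = (polygon_next g n t, 2)) \<or>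
      (\<exists>p q. a = (p, 0) \<and> b = (q, 0) \<and> (p, q) \<in> ?Q)"
    unfolding standard_gluing_def by auto
  have sides: "gl_sides ?K = {..<?m} \<times> {0, 1, 2}" unfolding gl_sides_def tris ..
  show ?thesis unfolding gluing_def
  proof (intro conjI)
    show "finite (gl_tris ?K)" unfolding tris by simp
    show "gl_pairs ?K \<subseteq> gl_sides ?K \<times> gl_sides ?K"
    proof (rule subrelI)
      fix a b assume "(a, b) \<in> gl_pairs ?K"
      then show "(a, b) \<in> gl_sides ?K \<times> gl_sides ?K"
        unfolding pairs sides using polygon_next_less polygon_pairs_bounds by fastforce
    qed
    have "a \<noteq> b" if "(a, b) \<in> gl_pairs ?K" for a b
      using that polygon_pairs_bounds unfolding pairs by fastforce
    then show "\<forall>(a, b)\<in>gl_pairs ?K. a \<noteq> b" by blast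
    have unique: "(a, b) = (a', b')"
      if "(a, b) \<in> gl_pairs ?K" "(a', b') \<in> gl_pairs ?K" "{a, b} \<inter> {a', b'} \<noteq> {}" for a b a' b'
    proof -
      have ov: "a = a' \<or> a = b' \<or> b = a' \<or> b = b'" using that(3) by blast
      show ?thesis using that(1,2) unfolding pairs
      proof (elim disjE exE conjE)
        fix t t' assume *: "a = (t, 1)" "b = (polygon_next g n t, 2)" "a' = (t', 1)" "b' = (polygon_next g n t', 2)"
        have "t = t' \<or> polygon_next g n t = polygon_next g n t'" using ov unfolding * by simp
        then have "t = t'" using polygon_next_inj by blast
        then show ?thesis unfolding * by simp
      next
        fix p q p' q' assume *: "a = (p, 0)" "b = (q, 0)" "(p, q) \<in> ?Q" "a' = (p', 0)" "b' = (q', 0)" "(p', q') \<in> ?Q"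
        have "p = p' \<or> p = q' \<or> q = p' \<or> q = q'"
          using ov unfolding *(1,2,4,5) prod.inject by blast
        then show ?thesis using polygon_pairs_eq[OF *(3) *(6)] unfolding *(1,2,4,5) by blast
      qed (use ov in simp_all)
    qed
    have unique': "x = y" if "x \<in> gl_pairs ?K" "y \<in> gl_pairs ?K" "{fst x, snd x} \<inter> {fst y, snd y} \<noteq> {}" for x y
      by (rule unique[of "fst x" "snd x" "fst y" "snd y", unfolded prod.collapse, OF that])
    show "\<forall>(a, b)\<in>gl_pairs ?K. \<forall>(a', b')\<in>gl_pairs ?K. {a, b} \<inter> {a', b'} \<noteq> {} \<longrightarrow> (a, b) = (a', b')"
      unfolding split_def prod.collapse by (intro ballI impI) (erule (2) unique')
    show "distinct (gl_bdry ?K)" unfolding bdry by (simp add: distinct_map inj_on_def)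
    have unpaired: "(t, k) \<in> set (gl_bdry ?K) \<longleftrightarrow> (t, k) \<in> gl_sides ?K - (Domain (gl_pairs ?K) \<union> Range (gl_pairs ?K))" for t k
    proof -
      have D: "(t, k) \<in> Domain (gl_pairs ?K) \<union> Range (gl_pairs ?K) \<longleftrightarrow>
          (k = 1 \<and> t < ?m) \<or> (k = 2 \<and> t < ?m) \<or> (k = 0 \<and> ((\<exists>q. (t, q) \<in> ?Q) \<or> (\<exists>p. (p, t) \<in> ?Q)))"
        using polygon_next_surj polygon_next_less by (auto simp: Domain_iff Range_iff pairs)
      have "(t, k) \<in> set (gl_bdry ?K) \<longleftrightarrow> k = 0 \<and> (\<exists>i<n. t = 3 * i + 1)"
        unfolding bdry by auto
      also have "\<dots> \<longleftrightarrow> t < ?m \<and> k = 0 \<and> \<not> ((\<exists>q. (t, q) \<in> ?Q) \<or> (\<exists>p. (p, t) \<in> ?Q))"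
      proof -
        have "t < ?m" if "\<exists>i<n. t = 3 * i + 1" using that unfolding polygon_size_def by auto
        then show ?thesis using polygon_sides_cases[of t g n] by blast
      qed
      also have "\<dots> \<longleftrightarrow> (t, k) \<in> gl_sides ?K - (Domain (gl_pairs ?K) \<union> Range (gl_pairs ?K))"
        unfolding Diff_iff D sides by auto
      finally show ?thesis .
    qed
    show "set (gl_bdry ?K) = gl_sides ?K - (Domain (gl_pairs ?K) \<union> Range (gl_pairs ?K))"
    proof (rule Set.set_eqI)
      fix s
      show "s \<in> set (gl_bdry ?K) \<longleftrightarrow> s \<in> gl_sides ?K - (Domain (gl_pairs ?K) \<union> Range (gl_pairs ?K))"
        by (rule unpaired[of "fst s" "snd s", unfolded prod.collapse])
    qed
  qed
qed

text \<open>The vertices of the standard triangulation: the base point 0 of the polygon, the tip 1 of \<open>t\<close>,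
  the apex 2, and the base point \<open>3 + i\<close> of \<open>x\<^sub>i\<close>.\<close>

definition polygon_vertex :: "nat \<Rightarrow> nat \<Rightarrow> nat \<Rightarrow> nat" where
  "polygon_vertex g n t = (if t < 3 * n \<and> t mod 3 \<noteq> 0 then 3 + t div 3
     else if t = 3 * n + 4 * g + 1 then 1 else 0)"

text \<open>Corner 1 of a triangle is the end of its polygon side, hence the start of the next
  polygon side.\<close>

definition corner_vertex :: "nat \<Rightarrow> nat \<Rightarrow> side \<Rightarrow> nat" where
  "corner_vertex g n s = (if snd s = 0 then polygon_vertex g n (fst s)
     else if snd s = 1 then polygon_vertex g n (polygon_next g n (fst s)) else 2)"

lemma standard_gluing_simps:
  "gl_tris (standard_gluing g n) = {..<polygon_size g n}"
  "gl_sides (standard_gluing g n) = {..<polygon_size g n} \<times> {0, 1, 2}"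
  "gl_bdry (standard_gluing g n) = map (\<lambda>i. (3 * i + 1, 0)) [0..<n]"
  unfolding gl_sides_def by (simp_all add: standard_gluing_def)

lemma standard_gluing_pairsE:
  assumes "(a, b) \<in> gl_pairs (standard_gluing g n)"
  obtains t where "t < polygon_size g n" "a = (t, 1)" "b = (polygon_next g n t, 2)"
  | p q where "a = (p, 0)" "b = (q, 0)" "(p, q) \<in> polygon_pairs g n"
  using assms unfolding standard_gluing_def by auto

lemma standard_gluing_spoke:
  "t < polygon_size g n \<Longrightarrow> ((t, 1), (polygon_next g n t, 2)) \<in> gl_pairs (standard_gluing g n)"
  unfolding standard_gluing_def by auto

lemma standard_gluing_outer:
  "(p, q) \<in> polygon_pairs g n \<Longrightarrow> ((p, 0), (q, 0)) \<in> gl_pairs (standard_gluing g n)"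
  unfolding standard_gluing_def by auto

lemma next_side_simps: "next_side (t, 0) = (t, 1)" "next_side (t, 1) = (t, 2)" "next_side (t, 2) = (t, 0)"
  unfolding next_side_def by auto

section \<open>Vertices of the standard gluing\<close>

text \<open>The vertex labels respect the gluing of polygon sides: opposite directions match the
  start of \<open>p\<close> with the end of \<open>q\<close>, which is the start of the side after
  \<open>q\<close>.\<close>

lemma polygon_vertex_pair:
  assumes "(p, q) \<in> polygon_pairs g n"
  shows "polygon_vertex g n p = polygon_vertex g n (polygon_next g n q)"
    and "polygon_vertex g n (polygon_next g n p) = polygon_vertex g n q"
proof -
  have v0: "polygon_vertex g n (3 * i) = 0" if "i \<le> n" for i
    using that unfolding polygon_vertex_def by simp
  have vx: "polygon_vertex g n (Suc (3 * i)) = 3 + i" "polygon_vertex g n (Suc (Suc (3 * i))) = 3 + i" if "i < n" for i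
  proof -
    have "Suc (3 * i) mod 3 = 1" "Suc (3 * i) div 3 = i" "Suc (Suc (3 * i)) mod 3 = 2" "Suc (Suc (3 * i)) div 3 = i"
      by presburger+
    moreover have "Suc (3 * i) < 3 * n" "Suc (Suc (3 * i)) < 3 * n" using that by simp_all
    ultimately show "polygon_vertex g n (Suc (3 * i)) = 3 + i" "polygon_vertex g n (Suc (Suc (3 * i))) = 3 + i"
      unfolding polygon_vertex_def by simp_all
  qed
  have vz: "polygon_vertex g n t = 0" if "3 * n \<le> t" "t \<le> 3 * n + 4 * g" for t
    using that unfolding polygon_vertex_def by simp
  have n: "polygon_next g n t = Suc t" if "t < 3 * n + 4 * g + 1" for t
    using that unfolding polygon_next_def polygon_size_def by simp
  have n0: "polygon_next g n (Suc (3 * n + 4 * g)) = 0"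
    unfolding polygon_next_def polygon_size_def by simp
  consider i where "i < n" "p = 3 * i" "q = Suc (Suc (3 * i))"
    | j where "j < g" "p = 3 * n + 4 * j" "q = Suc (Suc p)"
    | j where "j < g" "p = Suc (3 * n + 4 * j)" "q = Suc (Suc p)"
    | "p = 3 * n + 4 * g" "q = Suc p"
    using assms unfolding polygon_pairs_def by auto
  then have "polygon_vertex g n p = polygon_vertex g n (polygon_next g n q) \<and>
    polygon_vertex g n (polygon_next g n p) = polygon_vertex g n q"
  proof cases
    case (1 i)
    \<comment> \<open>The position after the block of x_i is again at the base point, even for the
      last block, where it is 3n.\<close>
    have "Suc (Suc (Suc (3 * i))) = 3 * Suc i" by simp
    then have "polygon_vertex g n (Suc (Suc (Suc (3 * i)))) = 0" using v0[of "Suc i"] \<open>i < n\<close> by (metis Suc_leI)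
    then show ?thesis using 1 v0[of i] by (simp add: n vx)
  next
    case (2 j)
    then show ?thesis by (simp add: n vz)
  next
    case (3 j)
    then show ?thesis by (simp add: n vz)
  next
    case 4
    then show ?thesis using v0[of 0] vz[of "3 * n + 4 * g"] by (simp add: n n0)
  qed
  then show "polygon_vertex g n p = polygon_vertex g n (polygon_next g n q)"
    and "polygon_vertex g n (polygon_next g n p) = polygon_vertex g n q" by auto
qed

lemma corner_vertex_eqI:
  assumes "(s, t) \<in> gl_corner_rel (standard_gluing g n)"
  shows "corner_vertex g n s = corner_vertex g n t"
  using assms
proof (rule gl_corner_rel_induct)
  fix a b assume "(a, b) \<in> gl_pairs (standard_gluing g n)"
  then show "corner_vertex g n a = corner_vertex g n (next_side b) \<and>
      corner_vertex g n (next_side a) = corner_vertex g n b"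
  proof (cases rule: standard_gluing_pairsE)
    case (1 t)
    then show ?thesis by (simp add: corner_vertex_def next_side_def)
  next
    case (2 p q)
    then show ?thesis
      using polygon_vertex_pair[OF 2(3)] by (simp add: corner_vertex_def next_side_def)
  qed
qed auto

text \<open>The converse to invariance of the labels: each corner is linked to a fixed corner chosen
  by its label, so equal labels mean equal vertices and counting labels counts vertices.\<close>

lemma corner_rel_representative:
  assumes s: "s \<in> gl_sides (standard_gluing g n)"
  shows "(s, case corner_vertex g n s of 0 \<Rightarrow> (0, 0) | Suc 0 \<Rightarrow> (3 * n + 4 * g + 1, 0)
      | Suc (Suc 0) \<Rightarrow> (0, 2) | Suc (Suc (Suc i)) \<Rightarrow> (3 * i + 1, 0)) \<in> gl_corner_rel (standard_gluing g n)"
proof -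
  let ?K = "standard_gluing g n" and ?m = "polygon_size g n"
  note [trans] = gl_corner_rel_trans
  note sym = gl_corner_rel_sym
  have next_less: "polygon_next g n t = Suc t" if "Suc t < ?m" for t
    using that unfolding polygon_next_def by simp
  have spoke1: "((t, 1), (polygon_next g n t, 0)) \<in> gl_corner_rel ?K" if "t < ?m" for t
    using gl_corner_rel_pair(1)[OF standard_gluing_spoke[OF that]] unfolding next_side_simps .
  have spoke2: "((t, 2), (polygon_next g n t, 2)) \<in> gl_corner_rel ?K" if "t < ?m" for t
    using gl_corner_rel_pair(2)[OF standard_gluing_spoke[OF that]] unfolding next_side_simps .
  have outer1: "((p, 0), (polygon_next g n q, 0)) \<in> gl_corner_rel ?K" if "(p, q) \<in> polygon_pairs g n" for p q
  proof -
    have "((p, 0), (q, 1)) \<in> gl_corner_rel ?K"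
      using gl_corner_rel_pair(1)[OF standard_gluing_outer[OF that]] unfolding next_side_simps .
    also have "((q, 1), (polygon_next g n q, 0)) \<in> gl_corner_rel ?K"
      using spoke1 polygon_pairs_bounds[OF that] by simp
    finally show ?thesis .
  qed
  have outer2: "((polygon_next g n p, 0), (q, 0)) \<in> gl_corner_rel ?K" if "(p, q) \<in> polygon_pairs g n" for p q
  proof -
    have "((polygon_next g n p, 0), (p, 1)) \<in> gl_corner_rel ?K"
      using sym[OF spoke1] polygon_pairs_bounds[OF that] by simp
    also have "((p, 1), (q, 0)) \<in> gl_corner_rel ?K"
      using gl_corner_rel_pair(2)[OF standard_gluing_outer[OF that]] unfolding next_side_simps .
    finally show ?thesis .
  qed
  \<comment> \<open>Crossing one spoke after another turns around the apex.\<close>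
  have apex: "((t, 2), (0, 2)) \<in> gl_corner_rel ?K" if "t < ?m" for t
    using that
  proof (induction t)
    case (Suc t)
    then show ?case using sym[OF spoke2[of t]] next_less[of t] gl_corner_rel_trans by (metis Suc_lessD)
  qed (rule gl_corner_rel_refl)
  have b0: "((3 * i, 0), (0, 0)) \<in> gl_corner_rel ?K" if "i \<le> n" for i
    using that
  proof (induction i)
    case (Suc i)
    then have Q: "(3 * i, 3 * i + 2) \<in> polygon_pairs g n" unfolding polygon_pairs_def by auto
    have "polygon_next g n (3 * i + 2) = 3 * Suc i"
      using Suc.prems next_less[of "3 * i + 2"] unfolding polygon_size_def by simp
    then show ?case using sym[OF outer1[OF Q]] Suc gl_corner_rel_trans by (metis Suc_leD)
  qed (simp add: gl_corner_rel_refl)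
  have b1: "((3 * i + 2, 0), (3 * i + 1, 0)) \<in> gl_corner_rel ?K" if "i < n" for i
  proof -
    have Q: "(3 * i, 3 * i + 2) \<in> polygon_pairs g n" using that unfolding polygon_pairs_def by auto
    have "polygon_next g n (3 * i) = 3 * i + 1"
      using that next_less[of "3 * i"] unfolding polygon_size_def by simp
    then show ?thesis using sym[OF outer2[OF Q]] by simp
  qed
  \<comment> \<open>The commutator pattern links the points of a handle in the order 0, 3, 2, 1, 4,
    so a handle adds no vertex; \<open>k = 4\<close> is the start of the following block.\<close>
  have handle: "((3 * n + 4 * j + k, 0), (3 * n + 4 * j, 0)) \<in> gl_corner_rel ?K"
    if "j < g" "k \<le> 4" for j k
  proof -
    let ?p = "3 * n + 4 * j"
    have Q: "(?p, ?p + 2) \<in> polygon_pairs g n" "(?p + 1, ?p + 3) \<in> polygon_pairs g n"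
      using that unfolding polygon_pairs_def by auto
    have nx: "polygon_next g n ?p = ?p + 1" "polygon_next g n (?p + 1) = ?p + 2"
      "polygon_next g n (?p + 2) = ?p + 3" "polygon_next g n (?p + 3) = ?p + 4"
      using that next_less[of ?p] next_less[of "?p + 1"] next_less[of "?p + 2"] next_less[of "?p + 3"]
      unfolding polygon_size_def by auto
    have 3: "((?p + 3, 0), (?p, 0)) \<in> gl_corner_rel ?K"
      using sym[OF outer1[OF Q(1)]] unfolding nx .
    have 2: "((?p + 2, 0), (?p, 0)) \<in> gl_corner_rel ?K"
      using outer2[OF Q(2)] 3 gl_corner_rel_trans unfolding nx by blast
    have 1: "((?p + 1, 0), (?p, 0)) \<in> gl_corner_rel ?K"
      using outer2[OF Q(1)] 2 gl_corner_rel_trans unfolding nx by blast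
    have 4: "((?p + 4, 0), (?p, 0)) \<in> gl_corner_rel ?K"
      using sym[OF outer1[OF Q(2)]] 1 gl_corner_rel_trans unfolding nx by blast
    have "k = 0 \<or> k = 1 \<or> k = 2 \<or> k = 3 \<or> k = 4" using that(2) by presburger
    then show ?thesis by (elim disjE) (use 1 2 3 4 gl_corner_rel_refl in simp_all)
  qed
  have h0: "((3 * n + 4 * j, 0), (0, 0)) \<in> gl_corner_rel ?K" if "j \<le> g" for j
    using that
  proof (induction j)
    case 0
    show ?case using b0[of n] by simp
  next
    case (Suc j)
    have "((3 * n + 4 * Suc j, 0), (3 * n + 4 * j, 0)) \<in> gl_corner_rel ?K"
      using handle[of j 4] Suc.prems by (simp add: add.commute add.left_commute)
    then show ?case using Suc gl_corner_rel_trans by (meson Suc_leD)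
  qed
  define rep where "rep = (\<lambda>v. case v of 0 \<Rightarrow> (0, 0) | Suc 0 \<Rightarrow> (3 * n + 4 * g + 1, 0)
      | Suc (Suc 0) \<Rightarrow> (0, 2) | Suc (Suc (Suc i)) \<Rightarrow> (3 * i + 1, 0 :: nat))"
  have poly: "((t, 0), rep (polygon_vertex g n t)) \<in> gl_corner_rel ?K" if "t < ?m" for t
  proof -
    consider "t < 3 * n" "t mod 3 = 0" | "t < 3 * n" "t mod 3 = 1" | "t < 3 * n" "t mod 3 = 2"
      | "3 * n \<le> t" "t \<le> 3 * n + 4 * g" | "t = 3 * n + 4 * g + 1"
      using \<open>t < ?m\<close> unfolding polygon_size_def by linarith
    then show ?thesis
    proof cases
      case 1
      then have "polygon_vertex g n t = 0" "t = 3 * (t div 3)" "t div 3 \<le> n"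
        unfolding polygon_vertex_def by auto
      then show ?thesis using b0[of "t div 3"] unfolding rep_def by simp
    next
      case 2
      define i where "i = t div 3"
      have "polygon_vertex g n t = 3 + i" "t = 3 * i + 1"
        using 2 div_mult_mod_eq[of t 3] unfolding polygon_vertex_def i_def by auto
      then show ?thesis using gl_corner_rel_refl unfolding rep_def by (simp add: numeral_3_eq_3)
    next
      case 3
      define i where "i = t div 3"
      have "polygon_vertex g n t = 3 + i" and t: "t = 3 * i + 2"
        using 3 div_mult_mod_eq[of t 3] unfolding polygon_vertex_def i_def by auto
      then have "rep (polygon_vertex g n t) = (3 * i + 1, 0)" unfolding rep_def by (simp add: numeral_3_eq_3)
      moreover have "i < n" using 3(1) t by simp
      ultimately show ?thesis using b1[of i] t by simp
    next
      case 4
      then have v: "polygon_vertex g n t = 0" unfolding polygon_vertex_def by auto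
      obtain s where s: "t = 3 * n + s" "s \<le> 4 * g" using 4 le_Suc_ex by fastforce
      have "((t, 0), (0, 0)) \<in> gl_corner_rel ?K"
      proof (cases "s = 4 * g")
        case True
        then show ?thesis using h0[of g] s by simp
      next
        case False
        define j where "j = s div 4"
        have j: "j < g" using s(2) False unfolding j_def by (simp add: less_mult_imp_div_less mult.commute)
        have "s = 4 * j + s mod 4" unfolding j_def by simp
        then have "((t, 0), (3 * n + 4 * j, 0)) \<in> gl_corner_rel ?K"
          using handle[OF j, of "s mod 4"] s(1) by (simp add: add.assoc)
        then show ?thesis using h0[of j] j gl_corner_rel_trans by (meson less_imp_le)
      qed
      then show ?thesis unfolding v rep_def by simp
    next
      case 5
      then have "polygon_vertex g n t = 1" unfolding polygon_vertex_def by auto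
      then show ?thesis using 5 gl_corner_rel_refl unfolding rep_def by simp
    qed
  qed
  obtain t k where tk: "s = (t, k)" "t < ?m" "k = 0 \<or> k = 1 \<or> k = 2"
    using s unfolding standard_gluing_simps by auto
  have "(s, rep (corner_vertex g n s)) \<in> gl_corner_rel ?K"
    using tk(3)
  proof (elim disjE)
    assume "k = 0"
    then show ?thesis using poly[OF tk(2)] tk(1) by (simp add: corner_vertex_def)
  next
    assume "k = 1"
    then show ?thesis
      using gl_corner_rel_trans[OF spoke1[OF tk(2)] poly[OF polygon_next_less[OF tk(2)]]] tk(1)
      by (simp add: corner_vertex_def)
  next
    assume "k = 2"
    then show ?thesis
      using apex[OF tk(2)] tk(1) by (simp add: corner_vertex_def rep_def numeral_2_eq_2)
  qed
  then show ?thesis unfolding rep_def .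
qed

lemma corner_rel_iff:
  assumes "s \<in> gl_sides (standard_gluing g n)" "t \<in> gl_sides (standard_gluing g n)"
  shows "(s, t) \<in> gl_corner_rel (standard_gluing g n) \<longleftrightarrow> corner_vertex g n s = corner_vertex g n t"
  using corner_vertex_eqI corner_rel_representative[OF assms(1)] corner_rel_representative[OF assms(2)]
    gl_corner_rel_sym gl_corner_rel_trans by metis

lemma corner_vertex_image: "corner_vertex g n ` gl_sides (standard_gluing g n) = {..<n + 3}"
proof
  show "corner_vertex g n ` gl_sides (standard_gluing g n) \<subseteq> {..<n + 3}"
    unfolding corner_vertex_def polygon_vertex_def by auto
  have "v \<in> corner_vertex g n ` gl_sides (standard_gluing g n)" if "v < n + 3" for v
  proof -
    have m: "0 < polygon_size g n" "3 * n + 4 * g + 1 < polygon_size g n" unfolding polygon_size_def by auto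
    consider "v = 0" | "v = 1" | "v = 2" | i where "v = 3 + i" "i < n"
    proof (cases "v < 3")
      case True
      then have "v = 0 \<or> v = 1 \<or> v = 2" by presburger
      then show ?thesis using that by blast
    next
      case False
      then have "v = 3 + (v - 3)" "v - 3 < n" using \<open>v < n + 3\<close> by auto
      then show ?thesis using that by blast
    qed
    then show ?thesis
    proof cases
      case 1
      then show ?thesis using m by (intro image_eqI[of _ _ "(0, 0)"])
          (auto simp: corner_vertex_def polygon_vertex_def standard_gluing_simps)
    next
      case 2
      then show ?thesis using m by (intro image_eqI[of _ _ "(3 * n + 4 * g + 1, 0)"])
          (auto simp: corner_vertex_def polygon_vertex_def standard_gluing_simps)
    next
      case 3
      then show ?thesis using m by (intro image_eqI[of _ _ "(0, 2)"])
          (auto simp: corner_vertex_def polygon_vertex_def standard_gluing_simps)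
    next
      case (4 i)
      have "(3 * i + 1) mod 3 = 1" "(3 * i + 1) div 3 = i" by presburger+
      then show ?thesis using 4 by (intro image_eqI[of _ _ "(3 * i + 1, 0)"])
          (simp_all add: corner_vertex_def polygon_vertex_def standard_gluing_simps polygon_size_def)
    qed
  qed
  then show "{..<n + 3} \<subseteq> corner_vertex g n ` gl_sides (standard_gluing g n)" by auto
qed

text \<open>Let m = 3n + 4g + 2 be the number of triangles. There are n + 3 vertices, and the 3m
  sides form P = (3m - n) / 2 pairs, so the Euler characteristic is (n + 3) - (P + n) + m = 3 - (m -
  n) / 2 = 2 - 2g - n.\<close>

theorem triangulates_standard_gluing: "triangulates (standard_gluing g n) g n"
proof -
  let ?K = "standard_gluing g n" and ?m = "polygon_size g n"
  note K = gluing_standard_gluing[of g n]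
  have "gl_connected ?K"
  proof -
    define R where "R = (\<lambda>(a, b). (fst a, fst b)) ` gl_pairs ?K"
    have spoke: "(t, polygon_next g n t) \<in> R" if "t < ?m" for t
      using standard_gluing_spoke[OF that] unfolding R_def by force
    have step: "(t, Suc t) \<in> R" if "Suc t < ?m" for t
      using spoke[of t] that by (simp add: polygon_next_def)
    have zero: "(0, t) \<in> (R \<union> R\<inverse>)\<^sup>*" if "t < ?m" for t
      using that
    proof (induction t)
      case (Suc t)
      then show ?case using step[of t] by (meson Suc_lessD UnI1 rtrancl.rtrancl_into_rtrancl)
    qed simp
    have "(s, t) \<in> (R \<union> R\<inverse>)\<^sup>*" if "s < ?m" "t < ?m" for s t
      using zero[OF that(1)] zero[OF that(2)] sym_rtrancl[OF sym_Un_converse, of R]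
      by (meson rtrancl_trans symD)
    moreover have "0 < ?m" unfolding polygon_size_def by simp
    ultimately show ?thesis
      unfolding gl_connected_def Let_def R_def[symmetric] standard_gluing_simps by auto
  qed
  moreover have "(s, next_side s) \<in> gl_corner_rel ?K" if s: "s \<in> set (gl_bdry ?K)" for s
  proof -
    obtain i where i: "i < n" "s = (3 * i + 1, 0)" using s unfolding standard_gluing_simps by auto
    have "s \<in> gl_sides ?K" using s gluing_sides_split[OF K] by auto
    moreover have "next_side s \<in> gl_sides ?K" using next_side_mem calculation .
    moreover have "corner_vertex g n s = corner_vertex g n (next_side s)"
    proof -
      have "polygon_next g n (3 * i + 1) = 3 * i + 2"
        using i unfolding polygon_next_def polygon_size_def by auto
      moreover have "(3 * i + 1) mod 3 = 1" "(3 * i + 1) div 3 = i" "(3 * i + 2) mod 3 = 2" "(3 * i + 2) div 3 = i"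
        by presburger+
      ultimately show ?thesis
        using i by (simp add: corner_vertex_def next_side_def polygon_vertex_def)
    qed
    ultimately show ?thesis using corner_rel_iff by blast
  qed
  moreover have "length (gl_bdry ?K) = n" by (simp add: standard_gluing_simps)
  moreover have "gl_euler_char ?K = 2 - 2 * int g - int n"
  proof -
    have "card (gl_vertices ?K) = card ((\<lambda>s. gl_corner_rel ?K `` {s}) ` gl_sides ?K)"
      unfolding gl_vertices_def quotient_def by (simp add: UNION_singleton_eq_range)
    also have "\<dots> = card (corner_vertex g n ` gl_sides ?K)"
      using corner_rel_iff by (intro card_image_eq_if_same_fibres) (simp add: gl_corner_class_eq_iff)
    also have "\<dots> = n + 3" unfolding corner_vertex_image by simp
    finally have "card (gl_vertices ?K) = n + 3" .
    moreover have "3 * ?m = 2 * card (gl_pairs ?K) + n"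
      using card_gl_sides[OF K] by (simp add: standard_gluing_simps card_cartesian_product)
    ultimately show ?thesis
      unfolding gl_euler_char_def standard_gluing_simps by (simp add: polygon_size_def)
  qed
  ultimately show ?thesis unfolding triangulates_def using K by blast
qed

section \<open>The state sum\<close>

text \<open>Once the matrix indices are fixed, the summand is a product over sides, and colors are
  coupled only by the metric of a glued pair. The singletons \<open>{\<beta> s}\<close> build the
  prescribed boundary colors into the domain.\<close>

lemma sum_colorings_factor:
  fixes F :: "side \<Rightarrow> 'x \<Rightarrow> complex"
  assumes K: "gluing K"
  shows "(\<Sum>c\<in>(\<Pi>\<^sub>E s\<in>gl_sides K. if s \<in> set (gl_bdry K) then {\<beta> s} else X).
      (\<Prod>s\<in>gl_sides K. F s (c s)) * (\<Prod>(p, q)\<in>gl_pairs K. h (c p) (c q))) =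
    (\<Prod>(p, q)\<in>gl_pairs K. \<Sum>x\<in>X. \<Sum>y\<in>X. h x y * (F p x * F q y)) *
    (\<Prod>s\<in>set (gl_bdry K). F s (\<beta> s))"
proof -
  let ?P = "gl_pairs K" and ?B = "set (gl_bdry K)"
  let ?X = "\<lambda>s. if s \<in> ?B then {\<beta> s} else X"
  \<comment> \<open>Blocks are indexed by the disjoint sum of pairs and boundary sides; for a pair,
    \<open>f\<close> collects the metric and the factors of both sides.\<close>
  define S where "S = case_sum (\<lambda>(p, q). {p, q}) (\<lambda>s::side. {s})"
  define f where "f = case_sum (\<lambda>(p, q) c. h (c p) (c q) * (F p (c p) * F q (c q))) (\<lambda>s c. F s (c s))"
  note pair = gluing_pair_sides[OF K] gluing_pair_neq[OF K] gluing_pair_not_bdry[OF K]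
  have fin: "finite ?P" "finite (?P <+> ?B)" using gluing_finite_pairs[OF K] by auto
  have sides: "gl_sides K = (\<Union>k\<in>?P <+> ?B. S k)"
    using gluing_sides_split[OF K] unfolding S_def Plus_def by auto
  have disj: "S k \<inter> S l = {}" if "k \<in> ?P <+> ?B" "l \<in> ?P <+> ?B" "k \<noteq> l" for k l
  proof -
    have cases: "(\<exists>p q. k = Inl (p, q) \<and> (p, q) \<in> ?P) \<or> (\<exists>s. k = Inr s \<and> s \<in> ?B)"
      if "k \<in> ?P <+> ?B" for k using that by auto
    show ?thesis
      using cases[OF that(1)] cases[OF that(2)]
    proof (elim disjE exE conjE)
      fix p q p' q' assume kl: "k = Inl (p, q)" "(p, q) \<in> ?P" "l = Inl (p', q')" "(p', q') \<in> ?P"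
      have "{p, q} \<inter> {p', q'} = {}"
        using gluing_pair_eq[OF K kl(2) kl(4)] that(3) kl(1,3) by blast
      then show ?thesis by (simp add: kl S_def)
    next
      fix p q s assume kl: "k = Inl (p, q)" "(p, q) \<in> ?P" "l = Inr s" "s \<in> ?B"
      show ?thesis using pair(4,5)[OF kl(2)] kl(4) by (auto simp: kl(1,3) S_def)
    next
      fix p q s assume kl: "k = Inr s" "s \<in> ?B" "l = Inl (p, q)" "(p, q) \<in> ?P"
      show ?thesis using pair(4,5)[OF kl(4)] kl(2) by (auto simp: kl(1,3) S_def)
    next
      fix s s' assume "k = Inr s" "l = Inr s'"
      then show ?thesis using that(3) by (auto simp: S_def)
    qed
  qed
  have cong: "f k c = f k c'" if "k \<in> ?P <+> ?B" "\<And>s. s \<in> S k \<Longrightarrow> c s = c' s" for k c c'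
    using that by (auto simp: f_def S_def Plus_def)
  have "(\<Prod>s\<in>gl_sides K. F s (c s)) * (\<Prod>(p, q)\<in>?P. h (c p) (c q)) = (\<Prod>k\<in>?P <+> ?B. f k c)" for c
  proof -
    have "(\<Prod>s\<in>gl_sides K. F s (c s)) = (\<Prod>k\<in>?P <+> ?B. \<Prod>s\<in>S k. F s (c s))"
      unfolding sides using fin disj by (intro prod.UNION_disjoint) (auto simp: S_def)
    also have "\<dots> = (\<Prod>(p, q)\<in>?P. F p (c p) * F q (c q)) * (\<Prod>s\<in>?B. F s (c s))"
    proof -
      have "(\<Prod>s\<in>S (Inl k). F s (c s)) = (case k of (p, q) \<Rightarrow> F p (c p) * F q (c q))" if "k \<in> ?P" for k
        using that pair(3) by (cases k) (auto simp: S_def)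
      moreover have "(\<Prod>s\<in>S (Inr k). F s (c s)) = F k (c k)" for k by (simp add: S_def)
      ultimately show ?thesis using fin by (simp add: prod.Plus comp_def cong: prod.cong)
    qed
    finally show ?thesis
      using fin by (simp add: prod.Plus f_def comp_def prod.distrib case_prod_unfold mult_ac)
  qed
  then have "(\<Sum>c\<in>Pi\<^sub>E (gl_sides K) ?X. (\<Prod>s\<in>gl_sides K. F s (c s)) * (\<Prod>(p, q)\<in>?P. h (c p) (c q))) =
      (\<Sum>c\<in>Pi\<^sub>E (\<Union>k\<in>?P <+> ?B. S k) ?X. \<Prod>k\<in>?P <+> ?B. f k c)"
    using sides by simp
  also have "\<dots> = (\<Prod>k\<in>?P <+> ?B. \<Sum>c\<in>Pi\<^sub>E (S k) ?X. f k c)"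
    by (rule sum_PiE_partition[OF fin(2) disj cong])
  also have "\<dots> = (\<Prod>k\<in>?P. \<Sum>c\<in>Pi\<^sub>E (S (Inl k)) ?X. f (Inl k) c) * (\<Prod>s\<in>?B. \<Sum>c\<in>Pi\<^sub>E (S (Inr s)) ?X. f (Inr s) c)"
    using fin by (simp add: prod.Plus comp_def)
  also have "(\<Prod>k\<in>?P. \<Sum>c\<in>Pi\<^sub>E (S (Inl k)) ?X. f (Inl k) c) =
      (\<Prod>(p, q)\<in>?P. \<Sum>x\<in>X. \<Sum>y\<in>X. h x y * (F p x * F q y))"
  proof (intro prod.cong refl)
    fix k assume k: "k \<in> ?P"
    obtain p q where [simp]: "k = (p, q)" by (cases k)
    have pq: "p \<noteq> q" "p \<notin> ?B" "q \<notin> ?B" using pair(3-5) k by auto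
    then have "(\<Sum>c\<in>Pi\<^sub>E {p, q} ?X. f (Inl k) c) = (\<Sum>x\<in>X. \<Sum>y\<in>X. h x y * (F p x * F q y))"
      by (simp add: sum_PiE_insert f_def)
    then show "(\<Sum>c\<in>Pi\<^sub>E (S (Inl k)) ?X. f (Inl k) c) =
        (case k of (p, q) \<Rightarrow> \<Sum>x\<in>X. \<Sum>y\<in>X. h x y * (F p x * F q y))"
      by (simp add: S_def)
  qed
  also have "(\<Prod>s\<in>?B. \<Sum>c\<in>Pi\<^sub>E (S (Inr s)) ?X. f (Inr s) c) = (\<Prod>s\<in>?B. F s (\<beta> s))"
    by (intro prod.cong refl) (simp add: S_def f_def sum_PiE_insert)
  finally show ?thesis .
qed

context finite_grp begin

section \<open>Expansion of the state sum in matrix entries\<close>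

abbreviation deg :: "'a rep set \<Rightarrow> nat" where
  "deg j \<equiv> fst (irr_rep j)"

abbreviation entry :: "'a rep set \<Rightarrow> 'a \<Rightarrow> nat \<Rightarrow> nat \<Rightarrow> complex" where
  "entry j x a b \<equiv> snd (irr_rep j) x $$ (a, b)"

lemma group_C_expand:
  assumes "x \<in> carrier G" "y \<in> carrier G" "z \<in> carrier G"
  shows "group_C G x y z = (\<Sum>j\<in>irr_classes G. of_nat (deg j) *
    (\<Sum>a<deg j. \<Sum>b<deg j. \<Sum>c<deg j. entry j x a b * entry j y b c * entry j z c a))"
proof -
  have "irr_character j (x \<otimes> y \<otimes> z) =
      (\<Sum>a<deg j. \<Sum>b<deg j. \<Sum>c<deg j. entry j x a b * entry j y b c * entry j z c a)"
    if j: "j \<in> irr_classes G" for j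
  proof -
    note r = irreducible_repD(1)[OF irr_rep_irreducible[OF j]]
    have "irr_character j (x \<otimes> y \<otimes> z) = (\<Sum>a<deg j. entry j (x \<otimes> (y \<otimes> z)) a a)"
      using assms by (simp add: irr_character_def rep_character_def m_assoc)
    also have "\<dots> = (\<Sum>a<deg j. \<Sum>b<deg j. \<Sum>c<deg j. entry j x a b * (entry j y b c * entry j z c a))"
      using assms by (simp add: rep_mult_entry[OF r] sum_distrib_left)
    finally show ?thesis by (simp add: mult.assoc)
  qed
  moreover have "group_C G x y z = (\<Sum>j\<in>irr_classes G. of_nat (deg j) * irr_character j (x \<otimes> y \<otimes> z))"
    using assms regular_character[of "x \<otimes> y \<otimes> z"] by (simp add: group_C_def)
  ultimately show ?thesis by simp
qed

text \<open>The metric forces y = x^-1, and its factor 1 / |G| cancels the |G| of Schur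
  orthogonality.\<close>

lemma metric_inv_contraction:
  assumes i: "i \<in> irr_classes G" and j: "j \<in> irr_classes G"
    and "a < deg i" "b < deg i" "c < deg j" "d < deg j"
  shows "(\<Sum>x\<in>carrier G. \<Sum>y\<in>carrier G. group_metric_inv G x y * (entry i x a b * entry j y c d)) =
    (if i = j \<and> a = d \<and> b = c then 1 / of_nat (deg i) else 0)"
proof -
  let ?N = "of_nat (card (carrier G)) :: complex"
  have N: "?N \<noteq> 0" using finite_carrier one_closed by auto
  have "(\<Sum>y\<in>carrier G. group_metric_inv G x y * (entry i x a b * entry j y c d)) =
      entry i x a b * entry j (inv x) c d / ?N" if x: "x \<in> carrier G" for x
  proof -
    have "x \<otimes> y = \<one> \<longleftrightarrow> y = inv x" if "y \<in> carrier G" for y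
      using x that by (metis inv_equality inv_inv r_inv)
    then have "(\<Sum>y\<in>carrier G. group_metric_inv G x y * (entry i x a b * entry j y c d)) =
        (\<Sum>y\<in>carrier G. if y = inv x then entry i x a b * entry j (inv x) c d / ?N else 0)"
      by (intro sum.cong) (auto simp: group_metric_inv_def)
    also have "\<dots> = entry i x a b * entry j (inv x) c d / ?N" using x finite_carrier by simp
    finally show ?thesis .
  qed
  then have "(\<Sum>x\<in>carrier G. \<Sum>y\<in>carrier G. group_metric_inv G x y * (entry i x a b * entry j y c d)) =
      (\<Sum>x\<in>carrier G. entry i x a b * entry j (inv x) c d) / ?N"
    by (simp add: sum_divide_distrib)
  also have "\<dots> = (if i = j \<and> a = d \<and> b = c then 1 / of_nat (deg i) else 0)"
  proof (cases "i = j")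
    case True
    then show ?thesis
      using orthogonality_same[OF irr_rep_irreducible[OF i], of a b c d] assms N by auto
  next
    case False
    then have "(irr_rep j, irr_rep i) \<notin> rep_iso G" using irr_rep_iso_eq[OF j i] by auto
    then show ?thesis
      using orthogonality_not_iso[OF irr_rep_irreducible[OF i] irr_rep_irreducible[OF j]] assms False by simp
  qed
  finally show ?thesis .
qed

text \<open>Distributing the product over triangles produces a labeling \<open>w\<close> of
  triangles by irreducible classes and, below it, a labeling \<open>a\<close> of corners by matrix
  indices whose range depends on \<open>w\<close>.\<close>

lemma triangle_weights_expand:
  assumes K: "gluing K" and c: "\<And>s. s \<in> gl_sides K \<Longrightarrow> c s \<in> carrier G"
  shows "(\<Prod>t\<in>gl_tris K. group_C G (c (t, 0)) (c (t, 1)) (c (t, 2))) =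
    (\<Sum>w\<in>gl_tris K \<rightarrow>\<^sub>E irr_classes G. (\<Prod>t\<in>gl_tris K. of_nat (deg (w t))) *
      (\<Sum>a\<in>(\<Pi>\<^sub>E s\<in>gl_sides K. {..<deg (w (fst s))}).
        \<Prod>s\<in>gl_sides K. entry (w (fst s)) (c s) (a s) (a (next_side s))))"
proof -
  let ?T = "gl_tris K" and ?I = "{0, 1, 2} :: nat set"
  note fin = gluing_finite_tris[OF K]
  define f where "f = (\<lambda>j t (a :: side \<Rightarrow> nat). \<Prod>i\<in>?I. entry j (c (t, i)) (a (t, i)) (a (next_side (t, i))))"
  have "group_C G (c (t, 0)) (c (t, 1)) (c (t, 2)) =
      (\<Sum>j\<in>irr_classes G. of_nat (deg j) * (\<Sum>a\<in>{t} \<times> ?I \<rightarrow>\<^sub>E {..<deg j}. f j t a))" if "t \<in> ?T" for t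
  proof -
    have "{t} \<times> ?I = {(t, 0), (t, 1), (t, 2)}" by auto
    then have "(\<Sum>a\<in>{t} \<times> ?I \<rightarrow>\<^sub>E {..<deg j}. f j t a) = (\<Sum>a<deg j. \<Sum>b<deg j. \<Sum>d<deg j.
        entry j (c (t, 0)) a b * entry j (c (t, 1)) b d * entry j (c (t, 2)) d a)" for j
      by (simp add: sum_PiE_insert f_def next_side_def mult.assoc)
    then show ?thesis
      using that c by (subst group_C_expand) (auto simp: gl_sides_def)
  qed
  then have "(\<Prod>t\<in>?T. group_C G (c (t, 0)) (c (t, 1)) (c (t, 2))) =
      (\<Prod>t\<in>?T. \<Sum>j\<in>irr_classes G. of_nat (deg j) * (\<Sum>a\<in>{t} \<times> ?I \<rightarrow>\<^sub>E {..<deg j}. f j t a))"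
    by simp
  also have "\<dots> = (\<Sum>w\<in>?T \<rightarrow>\<^sub>E irr_classes G. \<Prod>t\<in>?T.
      of_nat (deg (w t)) * (\<Sum>a\<in>{t} \<times> ?I \<rightarrow>\<^sub>E {..<deg (w t)}. f (w t) t a))"
    using fin finite_irr_classes by (intro prod_sum_PiE) auto
  also have "\<dots> = (\<Sum>w\<in>?T \<rightarrow>\<^sub>E irr_classes G. (\<Prod>t\<in>?T. of_nat (deg (w t))) *
      (\<Sum>a\<in>(\<Pi>\<^sub>E s\<in>gl_sides K. {..<deg (w (fst s))}).
        \<Prod>s\<in>gl_sides K. entry (w (fst s)) (c s) (a s) (a (next_side s))))"
  proof (intro sum.cong refl)
    fix w
    have sides: "gl_sides K = (\<Union>t\<in>?T. {t} \<times> ?I)" unfolding gl_sides_def by auto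
    have "(\<Prod>t\<in>?T. \<Sum>a\<in>{t} \<times> ?I \<rightarrow>\<^sub>E {..<deg (w t)}. f (w t) t a) =
        (\<Prod>t\<in>?T. \<Sum>a\<in>(\<Pi>\<^sub>E s\<in>{t} \<times> ?I. {..<deg (w (fst s))}). f (w t) t a)"
      by (intro prod.cong refl sum.cong PiE_cong) auto
    also have "\<dots> = (\<Sum>a\<in>(\<Pi>\<^sub>E s\<in>(\<Union>t\<in>?T. {t} \<times> ?I). {..<deg (w (fst s))}). \<Prod>t\<in>?T. f (w t) t a)"
    proof (rule sum_PiE_partition[symmetric, OF fin])
      fix t and a a' :: "side \<Rightarrow> nat"
      assume eq: "a s = a' s" if "s \<in> {t} \<times> ?I" for s
      \<comment> \<open>The successor stays in the same triangle, so the factor of \<open>t\<close>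
        depends on its own corners only.\<close>
      have "next_side (t, i) \<in> {t} \<times> ?I" for i unfolding next_side_def by auto
      then show "f (w t) t a = f (w t) t a'"
        unfolding f_def using eq by (intro prod.cong refl) (metis SigmaI insertI1)
    qed auto
    also have "\<dots> = (\<Sum>a\<in>(\<Pi>\<^sub>E s\<in>gl_sides K. {..<deg (w (fst s))}).
        \<Prod>s\<in>gl_sides K. entry (w (fst s)) (c s) (a s) (a (next_side s)))"
      unfolding sides[symmetric] f_def prod.cartesian_product case_prod_unfold prod.collapse fst_conv
      by (simp only: gl_sides_def)
    finally show "(\<Prod>t\<in>?T. of_nat (deg (w t)) * (\<Sum>a\<in>{t} \<times> ?I \<rightarrow>\<^sub>E {..<deg (w t)}. f (w t) t a)) =
        (\<Prod>t\<in>?T. of_nat (deg (w t))) * (\<Sum>a\<in>(\<Pi>\<^sub>E s\<in>gl_sides K. {..<deg (w (fst s))}).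
        \<Prod>s\<in>gl_sides K. entry (w (fst s)) (c s) (a s) (a (next_side s)))"
      by (simp add: prod.distrib)
  qed
  finally show ?thesis .
qed

text \<open>The sums over \<open>w\<close> and \<open>a\<close> are pulled outside and the colors
  are summed first, so that each glued pair either imposes its constraint or kills the term.\<close>

lemma state_sum_expand:
  assumes K: "gluing K" and \<beta>: "\<And>s. s \<in> set (gl_bdry K) \<Longrightarrow> \<beta> s \<in> carrier G"
  shows "state_sum (carrier G) (group_C G) (group_metric_inv G) K (map \<beta> (gl_bdry K)) =
    (\<Sum>w\<in>gl_tris K \<rightarrow>\<^sub>E irr_classes G. (\<Prod>t\<in>gl_tris K. of_nat (deg (w t))) *
      (\<Sum>a\<in>(\<Pi>\<^sub>E s\<in>gl_sides K. {..<deg (w (fst s))}).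
        (\<Prod>(p, q)\<in>gl_pairs K. if w (fst p) = w (fst q) \<and> a p = a (next_side q) \<and> a (next_side p) = a q
           then 1 / of_nat (deg (w (fst p))) else 0) *
        (\<Prod>s\<in>set (gl_bdry K). entry (w (fst s)) (\<beta> s) (a s) (a (next_side s)))))"
    (is "_ = (\<Sum>w\<in>?W. ?D w * (\<Sum>a\<in>?A w. ?E w a * ?F w a))")
proof -
  let ?h = "group_metric_inv G"
  define C where "C = (\<Pi>\<^sub>E s\<in>gl_sides K. if s \<in> set (gl_bdry K) then {\<beta> s} else carrier G)"
  define g where "g = (\<lambda>w a c. \<Prod>s\<in>gl_sides K. entry (w (fst s)) (c s) (a s) (a (next_side s)))"
  define H where "H = (\<lambda>c. \<Prod>(p, q)\<in>gl_pairs K. ?h (c p) (c q))"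
  have B: "set (gl_bdry K) \<subseteq> gl_sides K" using gluing_sides_split[OF K] by auto
  \<comment> \<open>The list equation for the boundary colors becomes a dependent function space,
    the form in which the sum factors.\<close>
  have C_eq: "{c \<in> gl_sides K \<rightarrow>\<^sub>E carrier G. map c (gl_bdry K) = map \<beta> (gl_bdry K)} = C"
    using B \<beta> unfolding C_def by (auto simp: PiE_iff extensional_def split: if_splits)
  have CG: "c s \<in> carrier G" if "c \<in> C" "s \<in> gl_sides K" for c s
    using that C_eq by blast
  have "state_sum (carrier G) (group_C G) ?h K (map \<beta> (gl_bdry K)) =
      (\<Sum>c\<in>C. (\<Sum>w\<in>?W. ?D w * (\<Sum>a\<in>?A w. g w a c)) * H c)"
    unfolding state_sum_def C_eq H_def
  proof (intro sum.cong refl arg_cong2[of _ _ _ _ "(*)"])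
    fix c assume "c \<in> C"
    then show "(\<Prod>t\<in>gl_tris K. group_C G (c (t, 0)) (c (t, 1)) (c (t, 2))) =
        (\<Sum>w\<in>?W. ?D w * (\<Sum>a\<in>?A w. g w a c))"
      unfolding g_def using CG by (intro triangle_weights_expand[OF K]) auto
  qed
  also have "\<dots> = (\<Sum>c\<in>C. \<Sum>w\<in>?W. ?D w * (\<Sum>a\<in>?A w. g w a c * H c))"
    by (simp add: sum_distrib_right mult.assoc)
  also have "\<dots> = (\<Sum>w\<in>?W. ?D w * (\<Sum>a\<in>?A w. \<Sum>c\<in>C. g w a c * H c))"
    by (subst sum.swap, simp only: sum_distrib_left[symmetric], subst sum.swap) (rule refl)
  also have "\<dots> = (\<Sum>w\<in>?W. ?D w * (\<Sum>a\<in>?A w. ?E w a * ?F w a))"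
  proof (intro sum.cong refl arg_cong2[of _ _ _ _ "(*)"])
    fix w a assume w: "w \<in> ?W" and a: "a \<in> ?A w"
    have "(\<Sum>c\<in>C. g w a c * H c) = (\<Prod>(p, q)\<in>gl_pairs K. \<Sum>x\<in>carrier G. \<Sum>y\<in>carrier G. ?h x y *
        (entry (w (fst p)) x (a p) (a (next_side p)) * entry (w (fst q)) y (a q) (a (next_side q)))) * ?F w a"
      unfolding g_def H_def C_def by (rule sum_colorings_factor[OF K])
    also have "(\<Prod>(p, q)\<in>gl_pairs K. \<Sum>x\<in>carrier G. \<Sum>y\<in>carrier G. ?h x y *
        (entry (w (fst p)) x (a p) (a (next_side p)) * entry (w (fst q)) y (a q) (a (next_side q)))) = ?E w a"
    proof (intro prod.cong refl, clarify)
      fix p1 p2 q1 q2 assume pq: "((p1, p2), (q1, q2)) \<in> gl_pairs K"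
      let ?p = "(p1, p2)" and ?q = "(q1, q2)"
      have s: "?p \<in> gl_sides K" "?q \<in> gl_sides K" using gluing_pair_sides[OF K pq] by auto
      then have T: "p1 \<in> gl_tris K" "q1 \<in> gl_tris K" by (auto simp: gl_sides_def)
      have al: "a s < deg (w (fst s))" if "s \<in> gl_sides K" for s using a that by auto
      \<comment> \<open>Orthogonality holds for indices in range; both ends of a side belong to one
        triangle and so share the same bound.\<close>
      have "fst (next_side s) = fst s" for s by (simp add: next_side_def)
      then have lt: "a ?p < deg (w p1)" "a (next_side ?p) < deg (w p1)"
        "a ?q < deg (w q1)" "a (next_side ?q) < deg (w q1)"
        using al[OF s(1)] al[OF s(2)] al[OF next_side_mem[OF s(1)]] al[OF next_side_mem[OF s(2)]] by auto
      show "(\<Sum>x\<in>carrier G. \<Sum>y\<in>carrier G. ?h x y *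
          (entry (w (fst ?p)) x (a ?p) (a (next_side ?p)) * entry (w (fst ?q)) y (a ?q) (a (next_side ?q)))) =
        (if w (fst ?p) = w (fst ?q) \<and> a ?p = a (next_side ?q) \<and> a (next_side ?p) = a ?q
           then 1 / of_nat (deg (w (fst ?p))) else 0)"
        unfolding fst_conv by (rule metric_inv_contraction) (use w T lt in auto)
    qed
    finally show "(\<Sum>c\<in>C. g w a c * H c) = ?E w a * ?F w a" .
  qed
  finally show ?thesis .
qed

section \<open>Evaluation on a connected surface\<close>

text \<open>A labeling with nonzero \<open>Z\<close> agrees across every glued pair, so
  connectedness makes it constant.\<close>

lemma sum_labelings_connected:
  assumes con: "gl_connected K" and fin: "finite (gl_tris K)"
    and zero: "\<And>w p q. w \<in> gl_tris K \<rightarrow>\<^sub>E J \<Longrightarrow> (p, q) \<in> gl_pairs K \<Longrightarrow> w (fst p) \<noteq> w (fst q) \<Longrightarrow> Z w = (0 :: complex)"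
    and J: "finite J"
  shows "(\<Sum>w\<in>gl_tris K \<rightarrow>\<^sub>E J. Z w) = (\<Sum>j\<in>J. Z (\<lambda>t\<in>gl_tris K. j))"
proof -
  let ?T = "gl_tris K" and ?c = "\<lambda>j. \<lambda>t\<in>gl_tris K. j"
  obtain t0 where t0: "t0 \<in> ?T" using con unfolding gl_connected_def by auto
  define R where "R = (\<lambda>(a, b). (fst a, fst b)) ` gl_pairs K"
  have conn: "(t0, t) \<in> (R \<union> R\<inverse>)\<^sup>*" if "t \<in> ?T" for t
    using con t0 that unfolding gl_connected_def Let_def R_def by blast
  have "Z w = 0" if w: "w \<in> ?T \<rightarrow>\<^sub>E J" "w \<notin> ?c ` J" for w
  proof (rule ccontr)
    assume "Z w \<noteq> 0"
    then have eq: "w (fst p) = w (fst q)" if "(p, q) \<in> gl_pairs K" for p q using zero w(1) that by blast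
    have "w t = w t0" if "t \<in> ?T" for t
      using conn[OF that]
    proof (induction rule: rtrancl_induct)
      case (step t u)
      then show ?case using eq unfolding R_def by auto
    qed simp
    then have "w = ?c (w t0)" using w(1) by (auto simp: fun_eq_iff PiE_iff extensional_def)
    then show False using w t0 by blast
  qed
  then have "(\<Sum>w\<in>?T \<rightarrow>\<^sub>E J. Z w) = (\<Sum>w\<in>?c ` J. Z w)"
    using fin J by (intro sum.mono_neutral_right finite_PiE) auto
  \<comment> \<open>The triangle \<open>t0\<close> ensures that different classes give different
    constant labelings.\<close>
  also have "\<dots> = (\<Sum>j\<in>J. Z (?c j))"
    using t0 by (intro sum.reindex_cong[of ?c]) (auto intro!: inj_onI dest!: fun_cong[of _ _ t0])
  finally show ?thesis .
qed

text \<open>The value depends on \<open>K\<close> only through the genus and the boundary colors,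
  which is invariance under retriangulation. The power is an integer power since 2g - 2 + n is
  negative for a sphere with at most one boundary circle.\<close>

lemma state_sum_triangulation:
  assumes tri: "triangulates K g n" and xs: "length xs = n" "set xs \<subseteq> carrier G"
  shows "state_sum (carrier G) (group_C G) (group_metric_inv G) K xs =
    (\<Sum>j\<in>irr_classes G. (\<Prod>x\<leftarrow>xs. irr_character j x) / irr_character j \<one> powi (2 * int g - 2 + int n))"
proof -
  have K: "gluing K" and con: "gl_connected K" and len: "length (gl_bdry K) = n"
    and loops: "\<And>s. s \<in> set (gl_bdry K) \<Longrightarrow> (s, next_side s) \<in> gl_corner_rel K"
    and euler: "gl_euler_char K = 2 - 2 * int g - int n"
    using tri unfolding triangulates_def by auto
  let ?T = "gl_tris K" and ?S = "gl_sides K" and ?P = "gl_pairs K" and ?B = "set (gl_bdry K)"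
  have dist: "distinct (gl_bdry K)" using K unfolding gluing_def by blast
  \<comment> \<open>Reads \<open>xs\<close> as a function on boundary sides, which is consistent
    because \<open>gl_bdry\<close> has no repetitions.\<close>
  define \<beta> where "\<beta> = (\<lambda>s. the (map_of (zip (gl_bdry K) xs) s))"
  have xs_eq: "xs = map \<beta> (gl_bdry K)"
    using dist xs(1) len by (intro nth_equalityI) (auto simp: \<beta>_def map_of_zip_nth)
  then have \<beta>: "\<beta> s \<in> carrier G" if "s \<in> ?B" for s using xs(2) that by auto
  define Z where "Z = (\<lambda>w. (\<Prod>t\<in>?T. of_nat (deg (w t))) *
      (\<Sum>a\<in>(\<Pi>\<^sub>E s\<in>?S. {..<deg (w (fst s))}).
        (\<Prod>(p, q)\<in>?P. if w (fst p) = w (fst q) \<and> a p = a (next_side q) \<and> a (next_side p) = a q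
           then 1 / of_nat (deg (w (fst p))) else 0) *
        (\<Prod>s\<in>?B. entry (w (fst s)) (\<beta> s) (a s) (a (next_side s)))))"
  have fin: "finite ?T" "finite ?P" using gluing_finite_tris[OF K] gluing_finite_pairs[OF K] by auto
  have "Z w = 0" if "(p, q) \<in> ?P" "w (fst p) \<noteq> w (fst q)" for w p q
  proof -
    have prod0: "(\<Prod>(p, q)\<in>?P. if w (fst p) = w (fst q) \<and> a p = a (next_side q) \<and> a (next_side p) = a q
           then 1 / of_nat (deg (w (fst p))) else 0 :: complex) = 0" for a
      using that fin by (intro prod_zero bexI[of _ "(p, q)"]) auto
    show ?thesis unfolding Z_def by (simp only: prod0 mult_zero_left mult_zero_right sum.neutral_const)
  qed
  then have "(\<Sum>w\<in>?T \<rightarrow>\<^sub>E irr_classes G. Z w) = (\<Sum>j\<in>irr_classes G. Z (\<lambda>t\<in>?T. j))"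
    using con fin(1) finite_irr_classes by (intro sum_labelings_connected) auto
  moreover have "state_sum (carrier G) (group_C G) (group_metric_inv G) K (map \<beta> (gl_bdry K)) =
      (\<Sum>w\<in>?T \<rightarrow>\<^sub>E irr_classes G. Z w)"
    unfolding Z_def by (rule state_sum_expand[OF K \<beta>])
  ultimately have "state_sum (carrier G) (group_C G) (group_metric_inv G) K xs =
      (\<Sum>j\<in>irr_classes G. Z (\<lambda>t\<in>?T. j))"
    using xs_eq by simp
  also have "\<dots> = (\<Sum>j\<in>irr_classes G. (\<Prod>x\<leftarrow>xs. irr_character j x) / irr_character j \<one> powi (2 * int g - 2 + int n))"
  proof (intro sum.cong refl)
    fix j assume j: "j \<in> irr_classes G"
    define d where "d = (of_nat (deg j) :: complex)"
    have d: "d \<noteq> 0" using irreducible_repD(2)[OF irr_rep_irreducible[OF j]] unfolding d_def by simp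
    have T: "fst s \<in> ?T" if "s \<in> ?S" for s using that by (auto simp: gl_sides_def)
    have BS: "?B \<subseteq> ?S" using gluing_sides_split[OF K] by auto
    define cond where "cond = (\<lambda>a :: side \<Rightarrow> nat. \<forall>(p, q)\<in>?P. a p = a (next_side q) \<and> a (next_side p) = a q)"
    have "Z (\<lambda>t\<in>?T. j) = d ^ card ?T * (\<Sum>a\<in>?S \<rightarrow>\<^sub>E {..<deg j}.
        (if cond a then (1 / d) ^ card ?P else 0) * (\<Prod>s\<in>?B. entry j (\<beta> s) (a s) (a (next_side s))))"
      unfolding Z_def
    proof (intro arg_cong2[of _ _ _ _ "(*)"] sum.cong)
      show "(\<Prod>t\<in>?T. of_nat (deg ((\<lambda>t\<in>?T. j) t))) = d ^ card ?T" by (simp add: d_def)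
      show "(\<Pi>\<^sub>E s\<in>?S. {..<deg ((\<lambda>t\<in>?T. j) (fst s))}) = (?S \<rightarrow>\<^sub>E {..<deg j})"
        using T by (intro PiE_cong) auto
      show "(\<Prod>s\<in>?B. entry ((\<lambda>t\<in>?T. j) (fst s)) (\<beta> s) (a s) (a (next_side s))) =
          (\<Prod>s\<in>?B. entry j (\<beta> s) (a s) (a (next_side s)))" for a
        using T BS by (intro prod.cong) auto
      fix a :: "side \<Rightarrow> nat"
      have "(\<Prod>(p, q)\<in>?P. if (\<lambda>t\<in>?T. j) (fst p) = (\<lambda>t\<in>?T. j) (fst q) \<and> a p = a (next_side q) \<and> a (next_side p) = a q
           then 1 / of_nat (deg ((\<lambda>t\<in>?T. j) (fst p))) else 0) =
          (\<Prod>(p, q)\<in>?P. if a p = a (next_side q) \<and> a (next_side p) = a q then 1 / d else 0)"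
      proof (intro prod.cong refl)
        fix x assume x: "x \<in> ?P"
        obtain p q where [simp]: "x = (p, q)" by (cases x)
        have "fst p \<in> ?T" "fst q \<in> ?T" using x T gluing_pair_sides[OF K, of p q] by simp_all
        then show "(case x of (p, q) \<Rightarrow> if (\<lambda>t\<in>?T. j) (fst p) = (\<lambda>t\<in>?T. j) (fst q) \<and> a p = a (next_side q) \<and> a (next_side p) = a q
           then 1 / of_nat (deg ((\<lambda>t\<in>?T. j) (fst p))) else 0) =
          (case x of (p, q) \<Rightarrow> if a p = a (next_side q) \<and> a (next_side p) = a q then 1 / d else 0)"
          by (simp add: d_def)
      qed
      \<comment> \<open>A single violated pair makes the product vanish; otherwise every pair
        contributes 1 / d.\<close>
      also have "\<dots> = (if cond a then (1 / d) ^ card ?P else 0)"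
      proof (cases "cond a")
        case True
        then have "(\<Prod>(p, q)\<in>?P. if a p = a (next_side q) \<and> a (next_side p) = a q then 1 / d else 0) = (\<Prod>x\<in>?P. 1 / d)"
          by (intro prod.cong) (auto simp: cond_def)
        then show ?thesis using True by simp
      next
        case False
        then obtain x where "x \<in> ?P" "\<not> (case x of (p, q) \<Rightarrow> a p = a (next_side q) \<and> a (next_side p) = a q)"
          unfolding cond_def by blast
        then have "(\<Prod>(p, q)\<in>?P. if a p = a (next_side q) \<and> a (next_side p) = a q then 1 / d else 0) = 0"
          using fin by (intro prod_zero bexI[of _ x]) (auto split: prod.splits)
        then show ?thesis using False by simp
      qed
      finally show "(\<Prod>(p, q)\<in>?P. if (\<lambda>t\<in>?T. j) (fst p) = (\<lambda>t\<in>?T. j) (fst q) \<and> a p = a (next_side q) \<and> a (next_side p) = a q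
           then 1 / of_nat (deg ((\<lambda>t\<in>?T. j) (fst p))) else 0) = (if cond a then (1 / d) ^ card ?P else 0)" .
    qed
    also have "\<dots> = d ^ card ?T * ((1 / d) ^ card ?P * (\<Sum>a\<in>?S \<rightarrow>\<^sub>E {..<deg j}.
        if cond a then \<Prod>s\<in>?B. entry j (\<beta> s) (a s) (a (next_side s)) else 0))"
      by (rule arg_cong[of _ _ "(*) (d ^ card ?T)"], unfold sum_distrib_left, intro sum.cong refl) simp
    also have "(\<Sum>a\<in>?S \<rightarrow>\<^sub>E {..<deg j}. if cond a then \<Prod>s\<in>?B. entry j (\<beta> s) (a s) (a (next_side s)) else 0) =
        d ^ (card (gl_vertices K) - n) * (\<Prod>s\<in>?B. irr_character j (\<beta> s))"
      unfolding cond_def d_def irr_character_def rep_character_def len[symmetric]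
      by (rule sum_corner_labels[OF K loops])
    also have "(\<Prod>s\<in>?B. irr_character j (\<beta> s)) = (\<Prod>x\<leftarrow>xs. irr_character j x)"
      using prod.distinct_set_conv_list[OF dist] by (simp add: xs_eq comp_def)
    also have "d ^ card ?T * ((1 / d) ^ card ?P * (d ^ (card (gl_vertices K) - n) * (\<Prod>x\<leftarrow>xs. irr_character j x))) =
        (\<Prod>x\<leftarrow>xs. irr_character j x) / d powi (2 * int g - 2 + int n)"
    proof -
      \<comment> \<open>This bound makes the natural subtraction in the exponent exact, so the Euler
        characteristic can be read off over the integers.\<close>
      have "n \<le> card (gl_vertices K)" using card_bdry_le_card_vertices[OF K loops] len by simp
      then have e: "int (card ?T) + int (card (gl_vertices K) - n) - int (card ?P) = - (2 * int g - 2 + int n)"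
        using euler len unfolding gl_euler_char_def by (simp add: of_nat_diff)
      have "d ^ card ?T * ((1 / d) ^ card ?P * d ^ (card (gl_vertices K) - n)) =
          d powi (int (card ?T) + int (card (gl_vertices K) - n) - int (card ?P))"
        using d by (simp add: power_int_add power_int_diff power_one_over field_simps)
      also have "\<dots> = 1 / d powi (2 * int g - 2 + int n)"
        unfolding e by (simp only: power_int_minus divide_inverse mult_1_left)
      finally show ?thesis by (simp add: mult.assoc[symmetric])
    qed
    finally show "Z (\<lambda>t\<in>?T. j) = (\<Prod>x\<leftarrow>xs. irr_character j x) / irr_character j \<one> powi (2 * int g - 2 + int n)"
      unfolding irr_character_one[OF j] d_def .
  qed
  finally show ?thesis .
qed

end

section \<open>Correlation functions and their multilinear extension\<close>

lemma sum_lists_prod: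
  fixes f :: "'b \<Rightarrow> 'a \<Rightarrow> 'c :: comm_semiring_1"
  shows "(\<Sum>xs\<in>{xs. set xs \<subseteq> X \<and> length xs = length fs}. \<Prod>i<length fs. f (fs ! i) (xs ! i)) =
    (\<Prod>h\<leftarrow>fs. \<Sum>x\<in>X. f h x)"
proof (induction fs)
  case Nil
  have "{xs. set xs \<subseteq> X \<and> xs = []} = {[]}" by auto
  then show ?case by simp
next
  case (Cons h fs)
  let ?L = "{xs. set xs \<subseteq> X \<and> length xs = length fs}"
  have "(\<Sum>xs\<in>{xs. set xs \<subseteq> X \<and> length xs = length (h # fs)}. \<Prod>i<length (h # fs). f ((h # fs) ! i) (xs ! i)) =
      (\<Sum>(x, xs)\<in>X \<times> ?L. f h x * (\<Prod>i<length fs. f (fs ! i) (xs ! i)))"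
    by (rule sum.reindex_bij_witness[of _ "\<lambda>(x, xs). x # xs" "\<lambda>xs. (hd xs, tl xs)"])
      (auto simp: length_Suc_conv prod.lessThan_Suc_shift simp del: prod.lessThan_Suc)
  also have "\<dots> = (\<Sum>x\<in>X. f h x) * (\<Sum>xs\<in>?L. \<Prod>i<length fs. f (fs ! i) (xs ! i))"
    by (simp add: sum_product sum.cartesian_product)
  finally show ?case using Cons.IH by simp
qed

context finite_grp begin

text \<open>The standard gluing supplies the triangulation that the description demands; evaluating
  on it also shows that no other value qualifies.\<close>

lemma correlation_eq:
  assumes "set xs \<subseteq> carrier G"
  shows "correlation (carrier G) (group_C G) (group_metric_inv G) g xs =
    (\<Sum>j\<in>irr_classes G. (\<Prod>x\<leftarrow>xs. irr_character j x) /
      irr_character j \<one> powi (2 * int g - 2 + int (length xs)))"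
    (is "_ = ?v")
  unfolding correlation_def
proof (rule the_equality)
  have val: "state_sum (carrier G) (group_C G) (group_metric_inv G) K xs = ?v"
    if "triangulates K g (length xs)" for K
    using state_sum_triangulation[OF that refl assms] .
  show "(\<exists>K. triangulates K g (length xs)) \<and> (\<forall>K. triangulates K g (length xs) \<longrightarrow>
      state_sum (carrier G) (group_C G) (group_metric_inv G) K xs = ?v)"
    by (intro conjI exI allI impI) (rule triangulates_standard_gluing, rule val)
  fix v assume v: "(\<exists>K. triangulates K g (length xs)) \<and> (\<forall>K. triangulates K g (length xs) \<longrightarrow>
      state_sum (carrier G) (group_C G) (group_metric_inv G) K xs = v)"
  then obtain K where K: "triangulates K g (length xs)" by blast
  then have "state_sum (carrier G) (group_C G) (group_metric_inv G) K xs = v" using v by blast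
  then show "v = ?v" using val[OF K] by simp
qed

text \<open>The colors are summed independently, so each factor chi_j(x_i) becomes the linear
  extension of the character at the i-th coefficient function.\<close>

lemma correlation_lin_eq:
  "correlation_lin (carrier G) (group_C G) (group_metric_inv G) g fs =
    (\<Sum>j\<in>irr_classes G. (\<Prod>f\<leftarrow>fs. irr_character_lin G j f) /
      irr_character j \<one> powi (2 * int g - 2 + int (length fs)))"
proof -
  let ?L = "{xs. set xs \<subseteq> carrier G \<and> length xs = length fs}"
  let ?e = "2 * int g - 2 + int (length fs)"
  have "correlation_lin (carrier G) (group_C G) (group_metric_inv G) g fs =
      (\<Sum>xs\<in>?L. \<Sum>j\<in>irr_classes G.
        (\<Prod>i<length fs. (fs ! i) (xs ! i) * irr_character j (xs ! i)) / irr_character j \<one> powi ?e)"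
    unfolding correlation_lin_def
  proof (intro sum.cong refl)
    fix xs assume xs: "xs \<in> ?L"
    have "(\<Prod>x\<leftarrow>xs. irr_character j x) = (\<Prod>i<length fs. irr_character j (xs ! i))" for j
      using xs by (simp add: prod.list_conv_set_nth atLeast0LessThan)
    then show "(\<Prod>i<length fs. (fs ! i) (xs ! i)) *
        correlation (carrier G) (group_C G) (group_metric_inv G) g xs =
      (\<Sum>j\<in>irr_classes G. (\<Prod>i<length fs. (fs ! i) (xs ! i) * irr_character j (xs ! i)) /
        irr_character j \<one> powi ?e)"
      using xs by (simp add: correlation_eq sum_distrib_left prod.distrib)
  qed
  also have "\<dots> = (\<Sum>j\<in>irr_classes G. (\<Sum>xs\<in>?L. \<Prod>i<length fs. (fs ! i) (xs ! i) * irr_character j (xs ! i)) /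
      irr_character j \<one> powi ?e)"
    by (subst sum.swap) (simp add: sum_divide_distrib)
  also have "\<dots> = (\<Sum>j\<in>irr_classes G. (\<Prod>f\<leftarrow>fs. irr_character_lin G j f) / irr_character j \<one> powi ?e)"
    unfolding irr_character_lin_def
    by (simp only: sum_lists_prod[where f = "\<lambda>f x. f x * irr_character j x" for j])
  finally show ?thesis .
qed

end

theorem mainTheorem7:
  fixes G :: "('a, 'b) monoid_scheme" and g :: nat and \<alpha>s :: "'a set list"
  assumes "group G" and "finite (carrier G)"
    and "set \<alpha>s \<subseteq> conjugacy_classes G"
  shows "correlation_lin (carrier G) (group_C G) (group_metric_inv G) g (map class_coeff \<alpha>s) =
    (\<Sum>j \<in> irr_classes G.
       (\<Prod>\<alpha>\<leftarrow>\<alpha>s. irr_character_lin G j (class_coeff \<alpha>)) /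
       irr_character j \<one>\<^bsub>G\<^esub> powi (2 * int g - 2 + int (length \<alpha>s)))"
proof -
  interpret finite_grp G
    using assms by (intro finite_grp.intro finite_grp_axioms.intro)
  show ?thesis by (simp add: correlation_lin_eq comp_def)
qed

end
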